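(* Let $\lambda$ be a partition with at most $n$ parts and $R:=R_\lambda$. Let $\mathcal{A}_R=S_n^{R\text{-}312}$ and $\mathcal{P}_\lambda=\{Y_\lambda(\pi):\pi\in\mathcal{A}_R\}$; let $\mathcal{B}_R$ be the set of $R$-rightmost clump deleting chains and $\mathcal{Q}_\lambda$ the set of gapless $\lambda$-keys; let $\mathcal{C}_R=UG_R(n)$ and $\mathcal{R}_\lambda=\{M_\lambda(\gamma):\gamma\in\mathcal{C}_R\}$. Then: (i) tableau portrayal $B\mapsto Y_\lambda(B)$ is a bijection from $\mathcal{B}_R$ to $\mathcal{Q}_\lambda$, and $\gamma\mapsto M_\lambda(\gamma)$ is a bijection from $\mathcal{C}_R$ to $\mathcal{R}_\lambda$. (ii) $\mathcal{P}_\lambda=\mathcal{Q}_\lambda$; the map $\pi\mapsto B$ (with $B_h=\{\pi_1,\dots,\pi_{q_h}\}$) restricted to $\mathcal{A}_R$ induces the identity map from $\mathcal{P}_\lambda$ to $\mathcal{Q}_\lambda$; so an $R$-permutation is $R$-312-avoiding if and only if its $\lambda$-key is gapless. (iii) If $\pi\in S_n^R$ is $R$-312-avoiding, then $M_\lambda(\Psi_R(\pi))=Y_\lambda(\pi)$. Consequently $\mathcal{P}_\lambda=\mathcal{R}_\lambda$ and $\Psi_R:\mathcal{A}_R\to\mathcal{C}_R$ induces the identity map from $\mathcal{P}_\lambda$ to $\mathcal{R}_\lambda$.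
   Context: Fix $n\ge1$; $[m]=\{1,\dots,m\}$, $(a,b]=\{a+1,\dots,b\}$; $\mathrm{rank}^d(Q)$ = $d$-th largest element of finite $Q\subset\mathbb{Z}$. Partition $\lambda=(\lambda_1\ge\cdots\ge\lambda_n\ge0)$; boxes $(j,i)$, $1\le j\le\lambda_1$, $1\le i\le\zeta_j=\#\{i:\lambda_i\ge j\}$. $R_\lambda=\{q_1<\cdots<q_r\}\subseteq[n-1]$ = column lengths less than $n$; $q_0=0$, $q_{r+1}=n$, $p_h=q_h-q_{h-1}$, carrels $(q_{h-1},q_h]$. $R$-tuples $\nu\in[n]^n$; $UI_R(n)$: tuples with $\nu_i\ge i$ strictly increasing on each carrel. $S_n^R$: permutations $\pi$ of $[n]$ strictly increasing on each carrel; $R$-312-containing if there exist $h\in[r-1]$, $a\le q_h<b\le q_{h+1}<c\le n$ with $\pi_b<\pi_c<\pi_a$, else $R$-312-avoiding ($S_n^{R\text{-}312}$). $\Psi_R(\pi)_i=\mathrm{rank}^{q_h-i+1}(\{\pi_1,\dots,\pi_{q_h}\})$ for $i\in(q_{h-1},q_h]$. Gapless $R$-tuple: $\gamma\in UI_R(n)$ such that for each $h\in[r]$ with $\gamma_{q_h}>\gamma_{q_h+1}$, $s=\gamma_{q_h}-\gamma_{q_h+1}+1\le p_{h+1}$ and $\gamma_{q_h+t}=\gamma_{q_h}-s+t$, $t=1,\dots,s$; set $UG_R(n)$. An $R$-chain is $\emptyset=B_0\subset B_1\subset\cdots\subset B_r\subset B_{r+1}=[n]$ with $|B_h|=q_h$.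 A clump of a set of integers is a maximal subset of consecutive integers. The chain is $R$-rightmost clump deleting if for each $h\in[r]$, writing $B_{h+1}=L_1\cup\cdots\cup L_f$ as its clumps in increasing order, there is $e\in[f]$ with $L_e\cup\cdots\cup L_f\supseteq B_{h+1}\setminus B_h\supseteq L_{e+1}\cup\cdots\cup L_f$. Tableaux: $T_j(i)\in[n]$ strictly increasing down columns, weakly along rows; $\mathcal{T}_\lambda$, ordered entrywise; $B(T_j)$ = set of entries of column $j$. For $Q\subseteq[n]$, $Y(Q)$ is the column with entries $Q$ increasing downward. The tableau portrayal $Y_\lambda(B)$ of an $R$-chain has columns left to right: $\lambda_n$ copies of $Y([n])$, then for $h=r,\dots,1$, $\lambda_{q_h}-\lambda_{q_{h+1}}$ copies of $Y(B_h)$; for $\pi\in S_n^R$ the $\lambda$-key $Y_\lambda(\pi)$ is the portrayal of $B_h=\{\pi_1,\dots,\pi_{q_h}\}$. A $\lambda$-key is $Y\in\mathcal{T}_\lambda$ with $B(Y_l)\supseteq B(Y_j)$ for $l\le j$. A $\lambda$-key $Y$ is gapless if for every $h\in[r-1]$: letting $b$ be the smallest value in the columns of length $q_{h+1}$ not appearing in the columns of length $q_h$, and $m$ the largest value in the columns of length $q_h$, if $b<m$ then every integer of $[b,m]$ appears in the columns of length $q_{h+1}$. For $\alpha\in UI_R(n)$, $M_\lambda(\alpha)$ is the entrywise maximum of $\{T\in\mathcal{T}_\lambda:T_{\lambda_i}(i)=\alpha_i\text{ for all }i\text{ with }\lambda_i\ge1\}$ (a nonempty set closed under entrywise max). *)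

theory Defs
  imports "HOL-Library.FuncSet" "HOL-Combinatorics.Permutations"
begin

text \<open>
  Tuples, tableaux and chains are encoded as extensional functions on their index sets,
  so that HOL equality coincides with equality of the mathematical objects.
  A set \<open>R \<subseteq> [n - 1]\<close> with \<open>r = card R\<close> elements gives
  \<open>q\<^sub>0 = 0 < q\<^sub>1 < \<dots> < q\<^sub>r < q\<^sub>r\<^sub>+\<^sub>1 = n\<close>.
\<close>

definition qval :: "nat \<Rightarrow> nat set \<Rightarrow> nat \<Rightarrow> nat" where
  "qval n R h = (0 # sorted_list_of_set R @ [n]) ! h"

definition pval :: "nat \<Rightarrow> nat set \<Rightarrow> nat \<Rightarrow> nat" where
  "pval n R h = qval n R h - qval n R (h - 1)"

definition carrel :: "nat \<Rightarrow> nat set \<Rightarrow> nat \<Rightarrow> nat set" where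
  "carrel n R h = {qval n R (h - 1)<..qval n R h}"

definition rank_desc :: "nat \<Rightarrow> 'a::linorder set \<Rightarrow> 'a" where
  "rank_desc d Q = rev (sorted_list_of_set Q) ! (d - 1)"

definition carrel_increasing :: "nat \<Rightarrow> nat set \<Rightarrow> (nat \<Rightarrow> nat) \<Rightarrow> bool" where
  "carrel_increasing n R f \<longleftrightarrow> (\<forall>h\<in>{1..card R + 1}. strict_mono_on (carrel n R h) f)"

definition UI :: "nat \<Rightarrow> nat set \<Rightarrow> (nat \<Rightarrow> nat) set" where
  "UI n R = {\<nu> \<in> {1..n} \<rightarrow>\<^sub>E {1..n}. (\<forall>i\<in>{1..n}. i \<le> \<nu> i) \<and> carrel_increasing n R \<nu>}"

text \<open>
  The subtraction \<open>\<gamma>(q\<^sub>h) - s\<close> does not truncate: \<open>\<gamma>(q\<^sub>h) - s = \<gamma>(q\<^sub>h + 1) - 1\<close> and \<open>\<gamma>\<close> has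
  positive values.
\<close>
definition UG :: "nat \<Rightarrow> nat set \<Rightarrow> (nat \<Rightarrow> nat) set" where
  "UG n R = {\<gamma> \<in> UI n R. \<forall>h\<in>{1..card R}.
     \<gamma> (qval n R h) > \<gamma> (qval n R h + 1) \<longrightarrow>
     (let s = \<gamma> (qval n R h) - \<gamma> (qval n R h + 1) + 1 in
        s \<le> pval n R (h + 1) \<and>
        (\<forall>t\<in>{1..s}. \<gamma> (qval n R h + t) = \<gamma> (qval n R h) - s + t))}"

definition R_perms :: "nat \<Rightarrow> nat set \<Rightarrow> (nat \<Rightarrow> nat) set" where
  "R_perms n R = {\<pi>. \<pi> permutes {1..n} \<and> carrel_increasing n R \<pi>}"

definition R_312_containing :: "nat \<Rightarrow> nat set \<Rightarrow> (nat \<Rightarrow> nat) \<Rightarrow> bool" where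
  "R_312_containing n R \<pi> \<longleftrightarrow>
     (\<exists>h\<in>{1..card R - 1}. \<exists>a b c.
        1 \<le> a \<and> a \<le> qval n R h \<and> qval n R h < b \<and> b \<le> qval n R (h + 1) \<and>
        qval n R (h + 1) < c \<and> c \<le> n \<and> \<pi> b < \<pi> c \<and> \<pi> c < \<pi> a)"

definition R_312_avoiding_perms :: "nat \<Rightarrow> nat set \<Rightarrow> (nat \<Rightarrow> nat) set" where
  "R_312_avoiding_perms n R = {\<pi> \<in> R_perms n R. \<not> R_312_containing n R \<pi>}"

definition Psi :: "nat \<Rightarrow> nat set \<Rightarrow> (nat \<Rightarrow> nat) \<Rightarrow> nat \<Rightarrow> nat" where
  "Psi n R \<pi> = (\<lambda>i\<in>{1..n}.
     let h = (THE h. h \<in> {1..card R + 1} \<and> i \<in> carrel n R h)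
     in rank_desc (qval n R h - i + 1) (\<pi> ` {1..qval n R h}))"

definition R_chains :: "nat \<Rightarrow> nat set \<Rightarrow> (nat \<Rightarrow> nat set) set" where
  "R_chains n R = {B \<in> {0..card R + 1} \<rightarrow>\<^sub>E Pow {1..n}.
     B 0 = {} \<and> B (card R + 1) = {1..n} \<and>
     (\<forall>h\<in>{0..card R}. B h \<subset> B (h + 1)) \<and>
     (\<forall>h\<in>{0..card R + 1}. card (B h) = qval n R h)}"

definition consecutive :: "nat set \<Rightarrow> bool" where
  "consecutive L \<longleftrightarrow> (\<exists>a b. a \<le> b \<and> L = {a..b})"

definition clumps :: "nat set \<Rightarrow> nat set set" where
  "clumps Q = {L. consecutive L \<and> L \<subseteq> Q \<and>
     (\<forall>L'. consecutive L' \<and> L \<subseteq> L' \<and> L' \<subseteq> Q \<longrightarrow> L' = L)}"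

definition clump_list :: "nat set \<Rightarrow> nat set list \<Rightarrow> bool" where
  "clump_list Q Ls \<longleftrightarrow>
     set Ls = clumps Q \<and> sorted_wrt (\<lambda>L L'. \<forall>x\<in>L. \<forall>y\<in>L'. x < y) Ls"

text \<open>
  With \<open>Ls = [L\<^sub>1, \<dots>, L\<^sub>f]\<close>, \<open>\<Union>(set (drop e Ls))\<close> is \<open>L\<^sub>e\<^sub>+\<^sub>1 \<union> \<dots> \<union> L\<^sub>f\<close>.
\<close>
definition rightmost_clump_deleting_chains :: "nat \<Rightarrow> nat set \<Rightarrow> (nat \<Rightarrow> nat set) set" where
  "rightmost_clump_deleting_chains n R = {B \<in> R_chains n R. \<forall>h\<in>{1..card R}.
     \<exists>Ls. clump_list (B (h + 1)) Ls \<and>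
       (\<exists>e\<in>{1..length Ls}.
          B (h + 1) - B h \<subseteq> \<Union>(set (drop (e - 1) Ls)) \<and>
          \<Union>(set (drop e Ls)) \<subseteq> B (h + 1) - B h)}"

definition perm_chain :: "nat \<Rightarrow> nat set \<Rightarrow> (nat \<Rightarrow> nat) \<Rightarrow> nat \<Rightarrow> nat set" where
  "perm_chain n R \<pi> = (\<lambda>h\<in>{0..card R + 1}. \<pi> ` {1..qval n R h})"

text \<open>A partition is given by its values \<open>lam 1, \<dots>, lam n\<close>; other values of \<open>lam\<close> are never used.\<close>
definition is_partition :: "nat \<Rightarrow> (nat \<Rightarrow> nat) \<Rightarrow> bool" where
  "is_partition n lam \<longleftrightarrow> (\<forall>i\<in>{1..n}. \<forall>k\<in>{1..n}. i \<le> k \<longrightarrow> lam k \<le> lam i)"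

definition col_len :: "nat \<Rightarrow> (nat \<Rightarrow> nat) \<Rightarrow> nat \<Rightarrow> nat" where
  "col_len n lam j = card {i \<in> {1..n}. j \<le> lam i}"

definition R_of :: "nat \<Rightarrow> (nat \<Rightarrow> nat) \<Rightarrow> nat set" where
  "R_of n lam = {col_len n lam j | j. j \<in> {1..lam 1} \<and> col_len n lam j < n}"

text \<open>The box \<open>(j, i)\<close> lies in column \<open>j\<close> and row \<open>i\<close>.\<close>
definition boxes :: "nat \<Rightarrow> (nat \<Rightarrow> nat) \<Rightarrow> (nat \<times> nat) set" where
  "boxes n lam = (SIGMA j:{1..lam 1}. {1..col_len n lam j})"

definition tableaux :: "nat \<Rightarrow> (nat \<Rightarrow> nat) \<Rightarrow> (nat \<times> nat \<Rightarrow> nat) set" where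
  "tableaux n lam = {T \<in> boxes n lam \<rightarrow>\<^sub>E {1..n}.
     (\<forall>j i k. (j, i) \<in> boxes n lam \<and> (j, k) \<in> boxes n lam \<and> i < k \<longrightarrow> T (j, i) < T (j, k)) \<and>
     (\<forall>j l i. (j, i) \<in> boxes n lam \<and> (l, i) \<in> boxes n lam \<and> j \<le> l \<longrightarrow> T (j, i) \<le> T (l, i))}"

definition col_set :: "nat \<Rightarrow> (nat \<Rightarrow> nat) \<Rightarrow> (nat \<times> nat \<Rightarrow> nat) \<Rightarrow> nat \<Rightarrow> nat set" where
  "col_set n lam T j = {T (j, i) | i. i \<in> {1..col_len n lam j}}"

definition portrayal_columns :: "nat \<Rightarrow> (nat \<Rightarrow> nat) \<Rightarrow> (nat \<Rightarrow> nat set) \<Rightarrow> nat set list" where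
  "portrayal_columns n lam B = (let R = R_of n lam; q = qval n R in
     replicate (lam n) {1..n} @
     concat (map (\<lambda>h. replicate (lam (q h) - lam (q (h + 1))) (B h)) (rev [1..<card R + 1])))"

definition portrayal :: "nat \<Rightarrow> (nat \<Rightarrow> nat) \<Rightarrow> (nat \<Rightarrow> nat set) \<Rightarrow> nat \<times> nat \<Rightarrow> nat" where
  "portrayal n lam B = (\<lambda>(j, i)\<in>boxes n lam.
     sorted_list_of_set (portrayal_columns n lam B ! (j - 1)) ! (i - 1))"

definition key_of :: "nat \<Rightarrow> (nat \<Rightarrow> nat) \<Rightarrow> (nat \<Rightarrow> nat) \<Rightarrow> nat \<times> nat \<Rightarrow> nat" where
  "key_of n lam \<pi> = portrayal n lam (perm_chain n (R_of n lam) \<pi>)"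

definition lam_keys :: "nat \<Rightarrow> (nat \<Rightarrow> nat) \<Rightarrow> (nat \<times> nat \<Rightarrow> nat) set" where
  "lam_keys n lam = {Y \<in> tableaux n lam. \<forall>l\<in>{1..lam 1}. \<forall>j\<in>{1..lam 1}.
     l \<le> j \<longrightarrow> col_set n lam Y j \<subseteq> col_set n lam Y l}"

definition values_in_cols_of_length ::
    "nat \<Rightarrow> (nat \<Rightarrow> nat) \<Rightarrow> (nat \<times> nat \<Rightarrow> nat) \<Rightarrow> nat \<Rightarrow> nat set" where
  "values_in_cols_of_length n lam Y d =
     \<Union>(col_set n lam Y ` {j \<in> {1..lam 1}. col_len n lam j = d})"

definition gapless_keys :: "nat \<Rightarrow> (nat \<Rightarrow> nat) \<Rightarrow> (nat \<times> nat \<Rightarrow> nat) set" where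
  "gapless_keys n lam = {Y \<in> lam_keys n lam.
     let R = R_of n lam; q = qval n R; V = values_in_cols_of_length n lam Y in
     \<forall>h\<in>{1..card R - 1}.
       let b = Min (V (q (h + 1)) - V (q h)); m = Max (V (q h)) in
         b < m \<longrightarrow> {b..m} \<subseteq> V (q (h + 1))}"

definition tableaux_with_row_ends ::
    "nat \<Rightarrow> (nat \<Rightarrow> nat) \<Rightarrow> (nat \<Rightarrow> nat) \<Rightarrow> (nat \<times> nat \<Rightarrow> nat) set" where
  "tableaux_with_row_ends n lam \<alpha> =
     {T \<in> tableaux n lam. \<forall>i\<in>{1..n}. lam i \<ge> 1 \<longrightarrow> T (lam i, i) = \<alpha> i}"

definition row_end_max :: "nat \<Rightarrow> (nat \<Rightarrow> nat) \<Rightarrow> (nat \<Rightarrow> nat) \<Rightarrow> nat \<times> nat \<Rightarrow> nat" where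
  "row_end_max n lam \<alpha> =
     (\<lambda>x\<in>boxes n lam. Max {T x | T. T \<in> tableaux_with_row_ends n lam \<alpha>})"

text \<open>
  If \<open>P\<close> and \<open>Q\<close> are parametrized by \<open>f\<close> on \<open>A\<close> and by \<open>g\<close> on \<open>B\<close>, a map \<open>\<phi>\<close> from \<open>A\<close> to \<open>B\<close>
  induces \<open>F\<close> from \<open>P\<close> to \<open>Q\<close> if the square commutes; \<open>F\<close> is then determined on \<open>P\<close>.
\<close>
definition induces ::
    "('a \<Rightarrow> 'b) \<Rightarrow> 'a set \<Rightarrow> 'b set \<Rightarrow> ('a \<Rightarrow> 'p) \<Rightarrow> 'p set \<Rightarrow> ('b \<Rightarrow> 'q) \<Rightarrow> 'q set \<Rightarrow> ('p \<Rightarrow> 'q) \<Rightarrow> bool" where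
  "induces \<phi> A B f P g Q F \<longleftrightarrow>
     \<phi> \<in> A \<rightarrow> B \<and> f ` A = P \<and> g ` B = Q \<and> F \<in> P \<rightarrow> Q \<and> (\<forall>a\<in>A. F (f a) = g (\<phi> a))"

end

theory Submission imports Defs begin

text \<open>
  All objects are compared with \<open>R\<close>-chains. Call a step \<open>B \<subset> B'\<close> of a chain gapless if every integer
  between a new element \<open>x \<in> B' - B\<close> and an old element \<open>y \<in> B\<close> above \<open>x\<close> lies in \<open>B'\<close>. This one
  condition is equivalent to rightmost clump deletion, to \<open>R\<close>-312-avoidance of the permutation
  and to gaplessness of the key, and the last step of a chain always satisfies it.

  Since \<open>card (B h) = q h\<close>, the tuple \<open>\<Psi>\<^sub>R\<close> reads off the \<open>i\<close>-th least element of \<open>B h\<close> for \<open>i\<close> in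
  carrel \<open>h\<close>. These are exactly the row ends of the key, and the gapless condition forces the key
  to be the largest tableau with these row ends. Conversely a gapless tuple is realised by a gapless
  chain that is built from the bottom up: the values of the tuple on the next carrel become the
  largest elements of \<open>B (h + 1)\<close>, and the other missing elements are inserted directly below them.
\<close>

section \<open>Ranked elements of finite sets\<close>

definition kth_least :: "'a::linorder set \<Rightarrow> nat \<Rightarrow> 'a" where
  "kth_least Q i = sorted_list_of_set Q ! (i - 1)"

lemma strict_mono_on_kth_least: "strict_mono_on {1..card Q} (kth_least Q)"
  unfolding kth_least_def
  by (intro strict_mono_onI sorted_wrt_nth_less[where P = "(<)"]) auto

lemma bij_betw_kth_least:
  assumes "finite Q"
  shows "bij_betw (kth_least Q) {1..card Q} Q"
proof (rule bij_betw_imageI)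
  show "inj_on (kth_least Q) {1..card Q}"
    by (rule strict_mono_on_imp_inj_on[OF strict_mono_on_kth_least])
  have "kth_least Q ` {1..card Q} = kth_least Q ` Suc ` {..<card Q}"
    by (simp only: image_Suc_lessThan)
  also have "\<dots> = (!) (sorted_list_of_set Q) ` {..<card Q}"
    unfolding image_image by (simp add: kth_least_def)
  also have "\<dots> = Q"
    using nth_image[of "card Q" "sorted_list_of_set Q"] assms by (simp add: lessThan_atLeast0)
  finally show "kth_least Q ` {1..card Q} = Q" .
qed

lemma kth_least_mem: "finite Q \<Longrightarrow> i \<in> {1..card Q} \<Longrightarrow> kth_least Q i \<in> Q"
  using bij_betw_apply[OF bij_betw_kth_least] .

lemma kth_least_image_atLeast:
  assumes "finite Q" "k \<in> {1..card Q}"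
  shows "kth_least Q ` {k..card Q} = Q \<inter> {kth_least Q k..}"
proof -
  have "kth_least Q ` {i \<in> {1..card Q}. k \<le> i} = {x \<in> kth_least Q ` {1..card Q}. kth_least Q k \<le> x}"
    using strict_mono_on_less_eq[OF strict_mono_on_kth_least assms(2)] by auto
  moreover have "{i \<in> {1..card Q}. k \<le> i} = {k..card Q}" using assms(2) by auto
  ultimately show ?thesis using bij_betw_imp_surj_on[OF bij_betw_kth_least[OF assms(1)]] by auto
qed

lemma card_atMost_kth_least:
  assumes "finite Q" "i \<in> {1..card Q}"
  shows "card (Q \<inter> {..kth_least Q i}) = i"
proof -
  have "kth_least Q ` {k \<in> {1..card Q}. k \<le> i} = {x \<in> kth_least Q ` {1..card Q}. x \<le> kth_least Q i}"
    using strict_mono_on_less_eq[OF strict_mono_on_kth_least _ assms(2)] by auto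
  moreover have "{k \<in> {1..card Q}. k \<le> i} = {1..i}" using assms(2) by auto
  ultimately have "Q \<inter> {..kth_least Q i} = kth_least Q ` {1..i}"
    using bij_betw_imp_surj_on[OF bij_betw_kth_least[OF assms(1)]] by auto
  moreover have "inj_on (kth_least Q) {1..i}"
    using bij_betw_imp_inj_on[OF bij_betw_kth_least[OF assms(1)]] assms(2)
    by (auto intro: inj_on_subset)
  ultimately show ?thesis by (simp add: card_image)
qed

lemma kth_least_le_iff:
  assumes "finite Q" "i \<in> {1..card Q}"
  shows "kth_least Q i \<le> x \<longleftrightarrow> i \<le> card (Q \<inter> {..x})"
proof
  assume "kth_least Q i \<le> x"
  then have "card (Q \<inter> {..kth_least Q i}) \<le> card (Q \<inter> {..x})"
    using assms(1) by (intro card_mono) auto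
  then show "i \<le> card (Q \<inter> {..x})" using card_atMost_kth_least[OF assms] by simp
next
  assume rank: "i \<le> card (Q \<inter> {..x})"
  show "kth_least Q i \<le> x"
  proof (rule ccontr)
    assume "\<not> kth_least Q i \<le> x"
    then have "Q \<inter> {..x} \<subset> Q \<inter> {..kth_least Q i}" using kth_least_mem[OF assms] by fastforce
    then have "card (Q \<inter> {..x}) < i"
      using psubset_card_mono[of "Q \<inter> {..kth_least Q i}"] card_atMost_kth_least[OF assms] assms(1)
      by simp
    then show False using rank by simp
  qed
qed

lemma kth_least_card_atMost:
  assumes "finite Q" "x \<in> Q"
  shows "kth_least Q (card (Q \<inter> {..x})) = x"
proof -
  obtain i where "i \<in> {1..card Q}" "x = kth_least Q i"
    using bij_betw_imp_surj_on[OF bij_betw_kth_least[OF assms(1)]] assms(2) by blast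
  then show ?thesis using card_atMost_kth_least[OF assms(1)] by simp
qed

lemma kth_least_card:
  assumes "finite Q" "Q \<noteq> {}"
  shows "kth_least Q (card Q) = Max Q"
proof -
  have "Q \<inter> {..Max Q} = Q" using assms by auto
  then show ?thesis using kth_least_card_atMost[OF assms(1) Max_in[OF assms]] by simp
qed

lemma kth_least_antimono:
  assumes "finite B" "A \<subseteq> B" "i \<in> {1..card A}"
  shows "kth_least B i \<le> kth_least A i"
proof -
  have "finite A" "card A \<le> card B" using assms by (auto intro: finite_subset card_mono)
  have "i = card (A \<inter> {..kth_least A i})"
    using card_atMost_kth_least[OF \<open>finite A\<close> assms(3)] by simp
  also have "\<dots> \<le> card (B \<inter> {..kth_least A i})" using assms(1,2) by (intro card_mono) auto
  finally show ?thesis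
    using kth_least_le_iff[OF assms(1), of i] assms(3) \<open>card A \<le> card B\<close> by simp
qed

lemma le_kth_least:
  assumes "finite Q" "Q \<subseteq> {1..}" "i \<in> {1..card Q}"
  shows "i \<le> kth_least Q i"
proof -
  have "i = card (Q \<inter> {..kth_least Q i})" using card_atMost_kth_least[OF assms(1,3)] by simp
  also have "\<dots> \<le> card {1..kth_least Q i}" using assms(2) by (intro card_mono) auto
  finally show ?thesis by simp
qed

lemma kth_least_image:
  assumes "finite Q" "strict_mono_on Q f" "i \<in> {1..card Q}"
  shows "kth_least (f ` Q) i = f (kth_least Q i)"
proof -
  have mem: "kth_least Q i \<in> Q" by (rule kth_least_mem[OF assms(1,3)])
  have "f ` Q \<inter> {..f (kth_least Q i)} = f ` (Q \<inter> {..kth_least Q i})"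
    using strict_mono_on_less_eq[OF assms(2) _ mem] by auto
  moreover have "inj_on f (Q \<inter> {..kth_least Q i})"
    using strict_mono_on_imp_inj_on[OF assms(2)] by (rule inj_on_subset) simp
  ultimately have "card (f ` Q \<inter> {..f (kth_least Q i)}) = i"
    using card_atMost_kth_least[OF assms(1,3)] by (simp add: card_image)
  then show ?thesis using kth_least_card_atMost[of "f ` Q" "f (kth_least Q i)"] assms(1) mem by simp
qed

lemma kth_least_Un_above:
  assumes "finite A" "finite B" "\<And>a b. a \<in> A \<Longrightarrow> b \<in> B \<Longrightarrow> a < b" "i \<in> {1..card B}"
  shows "kth_least (A \<union> B) (card A + i) = kth_least B i"
proof -
  have mem: "kth_least B i \<in> B" by (rule kth_least_mem[OF assms(2,4)])
  then have "(A \<union> B) \<inter> {..kth_least B i} = A \<union> (B \<inter> {..kth_least B i})"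
    using assms(3) by (auto intro: less_imp_le)
  moreover have "card \<dots> = card A + i"
    using assms(1-3) card_atMost_kth_least[OF assms(2,4)] by (subst card_Un_disjoint) force+
  ultimately show ?thesis
    using kth_least_card_atMost[of "A \<union> B" "kth_least B i"] assms(1,2) mem by simp
qed

lemma kth_least_greaterThanAtMost:
  fixes a b :: nat
  assumes "i \<in> {1..b - a}"
  shows "kth_least {a<..b} i = a + i"
proof -
  have "i - 1 < b - a" using assms by auto
  then show ?thesis
    using assms nth_sorted_list_of_set_greaterThanAtMost by (simp add: kth_least_def)
qed

lemma kth_least_Un_image_above:
  fixes f :: "nat \<Rightarrow> 'a::linorder"
  assumes "finite L" "strict_mono_on {card L<..m} f"
    and below: "\<And>x k. x \<in> L \<Longrightarrow> k \<in> {card L<..m} \<Longrightarrow> x < f k" and i: "i \<in> {card L<..m}"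
  shows "kth_least (L \<union> f ` {card L<..m}) i = f i"
proof -
  have card_image: "card (f ` {card L<..m}) = m - card L"
    using strict_mono_on_imp_inj_on[OF assms(2)] by (simp add: card_image)
  have rank: "i - card L \<in> {1..m - card L}" using i by auto
  then have "kth_least (L \<union> f ` {card L<..m}) (card L + (i - card L)) =
      kth_least (f ` {card L<..m}) (i - card L)"
    using assms(1) below card_image by (intro kth_least_Un_above) auto
  also have "\<dots> = f (kth_least {card L<..m} (i - card L))"
    using rank by (intro kth_least_image assms(2)) auto
  also have "kth_least {card L<..m} (i - card L) = card L + (i - card L)"
    by (rule kth_least_greaterThanAtMost[OF rank])
  finally show ?thesis using i by simp
qed

lemma kth_least_interval:
  fixes Q :: "nat set"
  assumes "finite Q" "i \<in> {1..card Q}" "k \<in> {1..card Q}" "i \<le> k"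
    and "{kth_least Q i..kth_least Q k} \<subseteq> Q"
  shows "kth_least Q k = kth_least Q i + (k - i)"
proof -
  have ordered: "kth_least Q i \<le> kth_least Q k"
    using strict_mono_on_less_eq[OF strict_mono_on_kth_least assms(2,3)] assms(4) by simp
  then have "Q \<inter> {..kth_least Q k} = (Q \<inter> {..kth_least Q i}) \<union> {kth_least Q i<..kth_least Q k}"
    using assms(5) by auto
  moreover have "card \<dots> = card (Q \<inter> {..kth_least Q i}) + (kth_least Q k - kth_least Q i)"
    using assms(1) by (subst card_Un_disjoint) auto
  ultimately have "k = i + (kth_least Q k - kth_least Q i)"
    using card_atMost_kth_least[OF assms(1,2)] card_atMost_kth_least[OF assms(1,3)] by simp
  then show ?thesis using ordered by simp
qed

lemma rank_desc_eq_kth_least: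
  assumes "finite Q" "i \<in> {1..card Q}"
  shows "rank_desc (card Q - i + 1) Q = kth_least Q i"
  using assms by (simp add: rank_desc_def kth_least_def rev_nth)

section \<open>Gapless steps\<close>

definition gapless_step :: "'a::order set \<Rightarrow> 'a set \<Rightarrow> bool" where
  "gapless_step B B' \<longleftrightarrow> (\<forall>x\<in>B' - B. \<forall>y\<in>B. {x..y} \<subseteq> B')"

lemma gapless_stepD: "gapless_step B B' \<Longrightarrow> x \<in> B' - B \<Longrightarrow> y \<in> B \<Longrightarrow> {x..y} \<subseteq> B'"
  by (simp add: gapless_step_def)

lemma gapless_step_iff_Min_Max:
  fixes B B' :: "'a::linorder set"
  assumes "finite B'" "B \<subset> B'" "B \<noteq> {}"
  shows "gapless_step B B' \<longleftrightarrow> (Min (B' - B) < Max B \<longrightarrow> {Min (B' - B)..Max B} \<subseteq> B')"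
proof
  have fin: "finite B" "finite (B' - B)" "B' - B \<noteq> {}"
    using assms finite_subset by auto
  show "Min (B' - B) < Max B \<longrightarrow> {Min (B' - B)..Max B} \<subseteq> B'" if "gapless_step B B'"
    using gapless_stepD[OF that Min_in[OF fin(2,3)] Max_in[OF fin(1) assms(3)]] by simp
  show "gapless_step B B'" if gap: "Min (B' - B) < Max B \<longrightarrow> {Min (B' - B)..Max B} \<subseteq> B'"
    unfolding gapless_step_def
  proof (intro ballI subsetI)
    fix x y z assume x: "x \<in> B' - B" and y: "y \<in> B" and z: "z \<in> {x..y}"
    have bounds: "Min (B' - B) \<le> x" "y \<le> Max B" using x y fin by auto
    moreover have "x < y" using x y z by (cases "x = y") auto
    ultimately have "{Min (B' - B)..Max B} \<subseteq> B'" using gap by simp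
    then show "z \<in> B'" using z bounds by fastforce
  qed
qed

lemma new_element_le_kth_least:
  assumes "finite B" "finite B'" "i \<in> {1..card B'}"
    and "i \<le> card B \<Longrightarrow> kth_least B' i < kth_least B i"
  obtains x where "x \<in> B' - B" "x \<le> kth_least B' i"
proof (rule ccontr)
  assume "\<not> thesis"
  then have "B' \<inter> {..kth_least B' i} \<subseteq> B \<inter> {..kth_least B' i}" using that by auto
  then have "card (B' \<inter> {..kth_least B' i}) \<le> card (B \<inter> {..kth_least B' i})"
    using assms(1) by (intro card_mono) auto
  then have rank: "i \<le> card (B \<inter> {..kth_least B' i})"
    using card_atMost_kth_least[OF assms(2,3)] by simp
  also have "\<dots> \<le> card B" using assms(1) by (intro card_mono) auto
  finally have "i \<le> card B" .
  then show False using kth_least_le_iff[OF assms(1), of i] assms(3,4) rank by (simp add: leD)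
qed

lemma kth_least_Suc_card_le_Max:
  assumes "finite B'" "B \<subset> B'" "B \<noteq> {}" "x \<in> B' - B" "x < kth_least B' (card B + 1)"
  shows "kth_least B' (card B + 1) \<le> Max B"
proof (rule ccontr)
  let ?c = "kth_least B' (card B + 1)"
  assume "\<not> ?c \<le> Max B"
  have fin: "finite B" and "card B < card B'"
    using assms(1,2) finite_subset psubset_card_mono by blast+
  then have rank: "card B + 1 \<in> {1..card B'}" by simp
  have "y < ?c" if "y \<in> B" for y using Max_ge[OF fin that] \<open>\<not> ?c \<le> Max B\<close> by simp
  then have "insert x B \<subseteq> B' \<inter> {..?c} - {?c}"
    using assms(2,4,5) by (auto simp: less_le)
  then have "card (insert x B) \<le> card (B' \<inter> {..?c} - {?c})"
    using assms(1) by (intro card_mono) auto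
  then show False
    using card_atMost_kth_least[OF assms(1) rank] kth_least_mem[OF assms(1) rank] fin assms(4)
    by simp
qed

lemma gapless_step_above:
  assumes "finite B'" "B \<subset> B'" "gapless_step B B'" "y \<in> B"
  shows "{kth_least B' (card B + 1)..y} \<subseteq> B'"
proof -
  have "finite B" "card B < card B'" using assms finite_subset psubset_card_mono by blast+
  then obtain x where "x \<in> B' - B" "x \<le> kth_least B' (card B + 1)"
    using assms(1) by (auto elim: new_element_le_kth_least[of B B' "card B + 1"])
  then show ?thesis using gapless_stepD[OF assms(3) _ assms(4)] by force
qed

text \<open>
  This is what makes the key of a gapless chain the largest tableau with its row ends: an entry \<open>a\<close>
  of a column of length \<open>card B'\<close> is bounded by its right neighbour in the column of \<open>B\<close>, and by the
  first entry below row \<open>card B\<close> of its own column.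
\<close>
lemma le_kth_least_gapless:
  fixes B B' :: "nat set"
  assumes "finite B'" "B \<subset> B'" "gapless_step B B'" "i \<in> {1..card B}"
    and right: "a \<le> kth_least B i" and below: "a + (card B + 1 - i) \<le> kth_least B' (card B + 1)"
  shows "a \<le> kth_least B' i"
proof (cases "kth_least B i \<le> kth_least B' i")
  case True
  then show ?thesis using right by simp
next
  case False
  let ?b = "kth_least B' i" and ?c = "kth_least B' (card B + 1)"
  have fin: "finite B" and card: "card B < card B'"
    using assms finite_subset psubset_card_mono by blast+
  then have ranks: "i \<in> {1..card B'}" "card B + 1 \<in> {1..card B'}" using assms(4) by auto
  obtain x where x: "x \<in> B' - B" "x \<le> ?b"
    using False fin assms(1) ranks(1) by (auto elim: new_element_le_kth_least[of B B' i])
  have "B \<noteq> {}" using assms(4) by auto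
  have "x < ?c"
    using x(2) strict_mono_onD[OF strict_mono_on_kth_least ranks] assms(4) by simp
  then have "?c \<le> Max B" by (rule kth_least_Suc_card_le_Max[OF assms(1,2) \<open>B \<noteq> {}\<close> x(1)])
  then have "{?b..?c} \<subseteq> {x..Max B}" using x(2) by auto
  also have "\<dots> \<subseteq> B'" by (rule gapless_stepD[OF assms(3) x(1) Max_in[OF fin \<open>B \<noteq> {}\<close>]])
  finally have "{?b..?c} \<subseteq> B'" .
  then have "?c = ?b + (card B + 1 - i)"
    using kth_least_interval[OF assms(1) ranks] assms(4) by simp
  then show ?thesis using below by simp
qed

lemma ex_interval_complement_below:
  fixes B :: "nat set"
  assumes "finite B" "B \<subseteq> {1..}" "card B < c"
  obtains x where "1 \<le> x" "x \<le> c" "card (B \<inter> {..<x} \<union> {x..<c}) = card B"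
proof -
  let ?g = "\<lambda>x. int x - int (card (B \<inter> {..<x}))"
  have step: "\<bar>?g (Suc x) - ?g x\<bar> \<le> 1" for x
  proof -
    have "B \<inter> {..<Suc x} = (if x \<in> B then insert x (B \<inter> {..<x}) else B \<inter> {..<x})"
      by (auto simp: less_Suc_eq)
    then show ?thesis using assms(1) by simp
  qed
  have "B \<inter> {..<1} = {}" using assms(2) by auto
  moreover have "card (B \<inter> {..<c}) \<le> card B" using assms(1) by (intro card_mono) auto
  ultimately obtain x where x: "1 \<le> x" "x \<le> c" "?g x = int c - int (card B)"
    using nat_intermed_int_val[of 1 c ?g "int c - int (card B)"] step assms(3) by force
  have "card (B \<inter> {..<x} \<union> {x..<c}) = card (B \<inter> {..<x}) + (c - x)"
    using assms(1) by (subst card_Un_disjoint) auto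
  then show ?thesis using that x by simp
qed

text \<open>The missing elements are inserted directly below \<open>U\<close>, so that they leave no gap.\<close>
lemma gapless_extension:
  fixes B U :: "nat set"
  assumes "finite B" "B \<subseteq> {1..}" "finite U" "U \<noteq> {}" "card B < Min U"
    and cover: "\<And>y. y \<in> B \<Longrightarrow> {Min U..y} \<subseteq> U"
  obtains L where "L \<subseteq> {1..<Min U}" "card L = card B" "B \<subseteq> L \<union> U" "gapless_step B (L \<union> U)"
proof -
  obtain x where x: "1 \<le> x" "x \<le> Min U" "card (B \<inter> {..<x} \<union> {x..<Min U}) = card B"
    using ex_interval_complement_below[OF assms(1,2,5)] .
  let ?L = "B \<inter> {..<x} \<union> {x..<Min U}"
  have above_x: "z \<in> ?L \<union> U" if "x \<le> z" "z \<le> y" "y \<in> B" for y z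
    using cover[OF that(3)] that(1,2) by (cases "z < Min U") auto
  show thesis
  proof (rule that)
    show "?L \<subseteq> {1..<Min U}" using x(1,2) assms(2) by auto
    show "B \<subseteq> ?L \<union> U"
    proof
      fix y assume "y \<in> B"
      then show "y \<in> ?L \<union> U" using above_x[of y y] by (cases "y < x") auto
    qed
    show "gapless_step B (?L \<union> U)" unfolding gapless_step_def
    proof (intro ballI subsetI)
      fix u y z assume u: "u \<in> ?L \<union> U - B" and y: "y \<in> B" and z: "z \<in> {u..y}"
      have "x \<le> u" using u x(2) Min_le[OF assms(3), of u] by auto
      then show "z \<in> ?L \<union> U" using above_x[OF _ _ y] z by auto
    qed
  qed (rule x(3))
qed

section \<open>Clumps\<close>

lemma clumps_subset: "L \<in> clumps Q \<Longrightarrow> L \<subseteq> Q"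
  by (simp add: clumps_def)

lemma clumps_consecutiveE:
  assumes "L \<in> clumps Q"
  obtains a b where "a \<le> b" "L = {a..b}"
  using assms by (auto simp: clumps_def consecutive_def)

lemma clump_absorbs_consecutive:
  assumes "L \<in> clumps Q" "consecutive I" "I \<subseteq> Q" "L \<inter> I \<noteq> {}"
  shows "I \<subseteq> L"
proof -
  obtain a b where ab: "a \<le> b" "L = {a..b}" using clumps_consecutiveE[OF assms(1)] .
  obtain c d where cd: "c \<le> d" "I = {c..d}" using assms(2) by (auto simp: consecutive_def)
  have "L \<union> I = {min a c..max b d}" using assms(4) ab cd by auto
  moreover have "min a c \<le> max b d" using ab by linarith
  ultimately have "consecutive (L \<union> I)" unfolding consecutive_def by blast
  then have "L \<union> I = L" using assms(1,3) by (auto simp: clumps_def)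
  then show ?thesis by blast
qed

lemma clumps_disjoint: "L \<in> clumps Q \<Longrightarrow> L' \<in> clumps Q \<Longrightarrow> L \<noteq> L' \<Longrightarrow> L \<inter> L' = {}"
  using clump_absorbs_consecutive[of L Q L'] clump_absorbs_consecutive[of L' Q L]
  unfolding clumps_def by blast

lemma clumps_less:
  assumes "L \<in> clumps Q" "L' \<in> clumps Q" "L \<noteq> L'" "Min L \<le> Min L'" "x \<in> L" "y \<in> L'"
  shows "x < y"
proof (rule ccontr)
  assume "\<not> x < y"
  obtain a b where ab: "a \<le> b" "L = {a..b}" using clumps_consecutiveE[OF assms(1)] .
  obtain c d where cd: "c \<le> d" "L' = {c..d}" using clumps_consecutiveE[OF assms(2)] .
  have "Min L = a" "Min L' = c" using ab cd by (auto intro!: Min_eqI)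
  then have "a \<le> c" using assms(4) by simp
  then have "c \<in> L \<inter> L'" using \<open>\<not> x < y\<close> assms(5,6) ab cd by auto
  then show False using clumps_disjoint[OF assms(1-3)] by blast
qed

lemma Union_clumps:
  assumes "finite Q"
  shows "\<Union>(clumps Q) = Q"
proof
  show "Q \<subseteq> \<Union>(clumps Q)"
  proof
    fix x assume "x \<in> Q"
    then have "{x} \<in> {L. consecutive L \<and> L \<subseteq> Q}"
      by (auto simp: consecutive_def intro!: exI[of _ x])
    moreover have "finite {L. consecutive L \<and> L \<subseteq> Q}"
      using assms by (auto intro: finite_subset[of _ "Pow Q"])
    ultimately obtain L where "consecutive L" "L \<subseteq> Q" "x \<in> L"
      "\<forall>L'. consecutive L' \<and> L' \<subseteq> Q \<and> L \<subseteq> L' \<longrightarrow> L = L'"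
      using finite_has_maximal2[of "{L. consecutive L \<and> L \<subseteq> Q}" "{x}"] by auto
    then show "x \<in> \<Union>(clumps Q)" unfolding clumps_def by blast
  qed
qed (use clumps_subset in blast)

lemma clump_list_exists:
  assumes "finite Q"
  obtains Ls where "clump_list Q Ls"
proof -
  have "finite (clumps Q)"
    using assms clumps_subset by (intro finite_subset[of "clumps Q" "Pow Q"]) auto
  then obtain Ls where Ls: "set Ls = clumps Q" "distinct Ls" using finite_distinct_list by blast
  let ?Ls = "sort_key Min Ls"
  have "\<forall>x\<in>?Ls ! i. \<forall>y\<in>?Ls ! k. x < y" if "i < k" "k < length ?Ls" for i k
  proof -
    have "?Ls ! i \<in> clumps Q" "?Ls ! k \<in> clumps Q"
      using that Ls(1) nth_mem[of _ ?Ls] by simp_all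
    moreover have "?Ls ! i \<noteq> ?Ls ! k" using that Ls(2) by (simp add: nth_eq_iff_index_eq)
    moreover have "Min (?Ls ! i) \<le> Min (?Ls ! k)"
      using that sorted_nth_mono[OF sorted_sort_key[of Min Ls], of i k] by simp
    ultimately show ?thesis using clumps_less by blast
  qed
  then have "sorted_wrt (\<lambda>L L'. \<forall>x\<in>L. \<forall>y\<in>L'. x < y) ?Ls"
    unfolding sorted_wrt_iff_nth_less by blast
  then show thesis using that[of ?Ls] Ls(1) by (simp add: clump_list_def)
qed

lemma clump_list_nth: "clump_list Q Ls \<Longrightarrow> i < length Ls \<Longrightarrow> Ls ! i \<in> clumps Q"
  unfolding clump_list_def using nth_mem by blast

lemma clump_list_index:
  assumes "finite Q" "clump_list Q Ls" "x \<in> Q"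
  obtains i where "i < length Ls" "x \<in> Ls ! i"
proof -
  have "x \<in> \<Union>(set Ls)" using Union_clumps[OF assms(1)] assms(2,3) by (simp add: clump_list_def)
  then show thesis using that by (auto simp: in_set_conv_nth)
qed

lemma clump_list_index_mono:
  assumes "clump_list Q Ls" "i < length Ls" "k < length Ls" "x \<in> Ls ! i" "y \<in> Ls ! k" "x \<le> y"
  shows "i \<le> k"
proof (rule ccontr)
  assume "\<not> i \<le> k"
  moreover have "sorted_wrt (\<lambda>L L'. \<forall>x\<in>L. \<forall>y\<in>L'. x < y) Ls"
    using assms(1) by (simp add: clump_list_def)
  ultimately have "y < x" using sorted_wrt_nth_less[of _ Ls k i] assms(2,4,5) by fastforce
  then show False using assms(6) by simp
qed

lemma mem_Union_drop_clump_list_iff: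
  assumes "clump_list Q Ls" "i < length Ls" "x \<in> Ls ! i"
  shows "x \<in> \<Union>(set (drop e Ls)) \<longleftrightarrow> e \<le> i"
proof
  assume "x \<in> \<Union>(set (drop e Ls))"
  then obtain k where "x \<in> Ls ! (e + k)" "e + k < length Ls" by (auto simp: in_set_conv_nth)
  then show "e \<le> i" using clump_list_index_mono[OF assms(1) _ assms(2) _ assms(3)] by fastforce
next
  assume "e \<le> i"
  then have "Ls ! i \<in> set (drop e Ls)"
    using assms(2) by (auto simp: in_set_conv_nth intro!: exI[of _ "i - e"])
  then show "x \<in> \<Union>(set (drop e Ls))" using assms(3) by blast
qed

lemma gapless_step_if_clumps_deleted:
  assumes "finite B'" "B \<subset> B'" "clump_list B' Ls"
    and "B' - B \<subseteq> \<Union>(set (drop (e - 1) Ls))" "\<Union>(set (drop e Ls)) \<subseteq> B' - B"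
  shows "gapless_step B B'"
  unfolding gapless_step_def
proof (intro ballI)
  fix x y assume x: "x \<in> B' - B" and y: "y \<in> B"
  note drop_iff = mem_Union_drop_clump_list_iff[OF assms(3)]
  obtain i where i: "i < length Ls" "x \<in> Ls ! i"
    using clump_list_index[OF assms(1,3)] x by blast
  obtain k where k: "k < length Ls" "y \<in> Ls ! k"
    using clump_list_index[OF assms(1,3)] y assms(2) by blast
  have "e - 1 \<le> i" using drop_iff[OF i] x assms(4) by blast
  have "\<not> e \<le> k" using drop_iff[OF k] y assms(5) by blast
  show "{x..y} \<subseteq> B'"
  proof (cases "x \<le> y")
    case True
    then have "i = k"
      using clump_list_index_mono[OF assms(3) i(1) k(1) i(2) k(2)] \<open>e - 1 \<le> i\<close> \<open>\<not> e \<le> k\<close>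
      by simp
    note clump = clump_list_nth[OF assms(3) i(1)]
    obtain a b where "a \<le> b" "Ls ! i = {a..b}" using clumps_consecutiveE[OF clump] .
    then show ?thesis using i k \<open>i = k\<close> clumps_subset[OF clump] by auto
  qed simp
qed

lemma clumps_deleted_if_gapless_step:
  assumes "finite B'" "B \<subset> B'" "clump_list B' Ls" "gapless_step B B'"
  obtains e where "e \<in> {1..length Ls}"
    "B' - B \<subseteq> \<Union>(set (drop (e - 1) Ls))" "\<Union>(set (drop e Ls)) \<subseteq> B' - B"
proof -
  note drop_iff = mem_Union_drop_clump_list_iff[OF assms(3)]
  let ?x = "Min (B' - B)"
  have x: "?x \<in> B' - B" using assms(1,2) by (intro Min_in) auto
  then obtain i where i: "i < length Ls" "?x \<in> Ls ! i"
    using clump_list_index[OF assms(1,3)] by blast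
  have "d \<in> \<Union>(set (drop i Ls))" if d: "d \<in> B' - B" for d
  proof -
    obtain k where k: "k < length Ls" "d \<in> Ls ! k"
      using clump_list_index[OF assms(1,3)] d by blast
    have "?x \<le> d" using d assms(1) by simp
    then show ?thesis
      using drop_iff[OF k] clump_list_index_mono[OF assms(3) i(1) k(1) i(2) k(2)] by simp
  qed
  moreover have "y \<in> B' - B" if y: "y \<in> \<Union>(set (drop (i + 1) Ls))" for y
  proof (rule ccontr)
    obtain L where L: "L \<in> set Ls" "y \<in> L" using y by (auto dest: in_set_dropD)
    then obtain k where k: "k < length Ls" "y \<in> Ls ! k" by (auto simp: in_set_conv_nth)
    have "i + 1 \<le> k" using drop_iff[OF k] y by blast
    then have "\<not> y \<le> ?x" using clump_list_index_mono[OF assms(3) k(1) i(1) k(2) i(2)] by auto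
    assume "y \<notin> B' - B"
    then have "y \<in> B" using L assms(3) clumps_subset by (auto simp: clump_list_def)
    then have "{?x..y} \<subseteq> B'" by (rule gapless_stepD[OF assms(4) x])
    moreover have "consecutive {?x..y}" using \<open>\<not> y \<le> ?x\<close> by (auto simp: consecutive_def)
    ultimately have "{?x..y} \<subseteq> Ls ! i"
      using \<open>\<not> y \<le> ?x\<close> i(2)
      by (intro clump_absorbs_consecutive[OF clump_list_nth[OF assms(3) i(1)]]) auto
    then have "y \<in> Ls ! i" using \<open>\<not> y \<le> ?x\<close> by auto
    then show False using clump_list_index_mono[OF assms(3) k(1) i(1) k(2)] \<open>i + 1 \<le> k\<close> by fastforce
  qed
  ultimately show thesis using i(1) by (intro that[of "i + 1"]) auto
qed

lemma gapless_step_iff_clumps_deleted: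
  assumes "finite B'" "B \<subset> B'"
  shows "gapless_step B B' \<longleftrightarrow> (\<exists>Ls. clump_list B' Ls \<and> (\<exists>e\<in>{1..length Ls}.
    B' - B \<subseteq> \<Union>(set (drop (e - 1) Ls)) \<and> \<Union>(set (drop e Ls)) \<subseteq> B' - B))"
    (is "_ \<longleftrightarrow> ?deleted")
proof
  assume gap: "gapless_step B B'"
  obtain Ls where Ls: "clump_list B' Ls" using clump_list_exists[OF assms(1)] .
  obtain e where "e \<in> {1..length Ls}"
    "B' - B \<subseteq> \<Union>(set (drop (e - 1) Ls))" "\<Union>(set (drop e Ls)) \<subseteq> B' - B"
    using clumps_deleted_if_gapless_step[OF assms Ls gap] .
  then show ?deleted using Ls by blast
qed (use gapless_step_if_clumps_deleted[OF assms] in blast)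

section \<open>Carrels and chains\<close>

definition carrel_index :: "nat \<Rightarrow> nat set \<Rightarrow> nat \<Rightarrow> nat" where
  "carrel_index n R i = (THE h. h \<in> {1..card R + 1} \<and> i \<in> carrel n R h)"

definition gapless_chains :: "nat \<Rightarrow> nat set \<Rightarrow> (nat \<Rightarrow> nat set) set" where
  "gapless_chains n R = {B \<in> R_chains n R. \<forall>h\<in>{1..card R}. gapless_step (B h) (B (h + 1))}"

locale carrels =
  fixes n :: nat and R :: "nat set"
  assumes n_pos: "1 \<le> n" and R_sub: "R \<subseteq> {1..<n}"
begin

abbreviation "q \<equiv> qval n R"
abbreviation "r \<equiv> card R"

lemma finite_R: "finite R" using R_sub finite_subset by blast

lemma q_0 [simp]: "q 0 = 0" by (simp add: qval_def)

lemma q_last [simp]: "q (Suc r) = n" by (simp add: qval_def nth_append)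

lemma strict_mono_on_q: "strict_mono_on {..Suc r} q"
proof (rule strict_mono_onI)
  fix h k assume "k \<in> {..Suc r}" "h < k"
  moreover have "sorted_wrt (<) (0 # sorted_list_of_set R @ [n])"
    using R_sub finite_R n_pos by (auto simp: sorted_wrt_append)
  ultimately show "q h < q k"
    unfolding qval_def by (intro sorted_wrt_nth_less[where P = "(<)"]) simp_all
qed

lemma q_less_iff: "h \<le> Suc r \<Longrightarrow> k \<le> Suc r \<Longrightarrow> q h < q k \<longleftrightarrow> h < k"
  using strict_mono_on_less[OF strict_mono_on_q] by simp

lemma q_le_iff: "h \<le> Suc r \<Longrightarrow> k \<le> Suc r \<Longrightarrow> q h \<le> q k \<longleftrightarrow> h \<le> k"
  using strict_mono_on_less_eq[OF strict_mono_on_q] by simp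

lemma q_le_n: "h \<le> Suc r \<Longrightarrow> q h \<le> n"
  using q_le_iff[of h "Suc r"] by simp

lemma q_image: "q ` {1..r} = R"
proof -
  have "q ` {1..r} = q ` Suc ` {..<r}" by (simp only: image_Suc_lessThan)
  also have "\<dots> = (!) (sorted_list_of_set R) ` {..<r}"
    unfolding image_image by (intro image_cong) (auto simp: qval_def nth_append)
  also have "\<dots> = R"
    using nth_image[of r "sorted_list_of_set R"] finite_R by (simp add: lessThan_atLeast0)
  finally show ?thesis .
qed

lemma carrel_Suc: "carrel n R (Suc h) = {q h<..q (Suc h)}"
  by (simp add: carrel_def)

lemma carrel_subset: "h \<le> r \<Longrightarrow> carrel n R (Suc h) \<subseteq> {1..n}"
  using q_le_n[of "Suc h"] by (auto simp: carrel_Suc)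

lemma q_Suc_mem_carrel: "h \<le> r \<Longrightarrow> q (Suc h) \<in> carrel n R (Suc h)"
  using q_less_iff[of h "Suc h"] by (simp add: carrel_Suc)

lemma Suc_q_mem_carrel: "h \<le> r \<Longrightarrow> q h + 1 \<in> carrel n R (Suc h)"
  using q_less_iff[of h "Suc h"] by (simp add: carrel_Suc)

lemma carrel_increasingI:
  assumes "\<And>h. h \<le> r \<Longrightarrow> strict_mono_on (carrel n R (Suc h)) f"
  shows "carrel_increasing n R f"
  unfolding carrel_increasing_def
proof
  fix h assume "h \<in> {1..r + 1}"
  then show "strict_mono_on (carrel n R h) f" using assms[of "h - 1"] by auto
qed

lemma carrel_index_eqI:
  assumes "h \<le> r" "i \<in> carrel n R (Suc h)"
  shows "carrel_index n R i = Suc h"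
  unfolding carrel_index_def
proof (rule the_equality)
  fix k assume k: "k \<in> {1..r + 1} \<and> i \<in> carrel n R k"
  then obtain m where m: "k = Suc m" "m \<le> r" by (cases k) auto
  have "q h < q (Suc m)" "q m < q (Suc h)" using assms k m by (auto simp: carrel_Suc)
  then show "k = Suc h" using q_less_iff[of h "Suc m"] q_less_iff[of m "Suc h"] assms(1) m by simp
qed (use assms in auto)

lemma carrel_index_cases:
  assumes "i \<in> {1..n}"
  obtains h where "h \<le> r" "carrel_index n R i = Suc h" "i \<in> carrel n R (Suc h)"
proof -
  let ?k = "LEAST k. i \<le> q k"
  have last: "i \<le> q (Suc r)" using assms by simp
  have "i \<le> q ?k" "?k \<le> Suc r" using last by (rule LeastI, rule Least_le)
  moreover from this have "?k \<noteq> 0" using assms by (auto intro: ccontr)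
  then obtain h where h: "?k = Suc h" using not0_implies_Suc by blast
  moreover have "\<not> i \<le> q h" using not_less_Least[of h "\<lambda>k. i \<le> q k"] h by simp
  ultimately have "h \<le> r" "i \<in> carrel n R (Suc h)" by (simp_all add: carrel_Suc)
  then show ?thesis using that carrel_index_eqI by blast
qed

lemma carrel_index_le_iff:
  assumes "i \<in> {1..n}" "h \<le> Suc r"
  shows "carrel_index n R i \<le> h \<longleftrightarrow> i \<le> q h"
proof -
  obtain k where k: "k \<le> r" "carrel_index n R i = Suc k" "q k < i" "i \<le> q (Suc k)"
    using carrel_index_cases[OF assms(1)] by (auto simp: carrel_Suc)
  then show ?thesis using q_le_iff[of "Suc k" h] q_less_iff[of k h] assms(2) by auto
qed

lemma carrel_index_q: "h \<le> r \<Longrightarrow> carrel_index n R (q (Suc h)) = Suc h"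
  using carrel_index_eqI[OF _ q_Suc_mem_carrel] .

lemma R_chainsI:
  assumes "\<And>h. h \<le> Suc r \<Longrightarrow> B h \<subseteq> {1..n}" "\<And>h. h \<le> Suc r \<Longrightarrow> card (B h) = q h"
    and "\<And>h. h \<le> r \<Longrightarrow> B h \<subseteq> B (Suc h)"
  shows "restrict B {0..r + 1} \<in> R_chains n R"
proof -
  have fin: "finite (B h)" if "h \<le> Suc r" for h using assms(1)[OF that] finite_subset by blast
  have "B h \<subset> B (Suc h)" if "h \<le> r" for h
    using assms(2)[of h] assms(2)[of "Suc h"] assms(3)[OF that] q_less_iff[of h "Suc h"] that
    by auto
  moreover have "B 0 = {}" using assms(2)[of 0] fin[of 0] by simp
  moreover have "B (Suc r) = {1..n}" using assms(1,2)[of "Suc r"] by (intro card_subset_eq) auto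
  ultimately show ?thesis unfolding R_chains_def using assms(1,2) by (simp add: restrict_PiE_iff)
qed

context
  fixes B assumes B: "B \<in> R_chains n R"
begin

lemma chain_0: "B 0 = {}"
  and chain_last: "B (Suc r) = {1..n}"
  and chain_psubset: "h \<le> r \<Longrightarrow> B h \<subset> B (Suc h)"
  and chain_card: "h \<le> Suc r \<Longrightarrow> card (B h) = q h"
  and chain_sub: "h \<le> Suc r \<Longrightarrow> B h \<subseteq> {1..n}"
  using B unfolding R_chains_def by (force simp: PiE_iff)+

lemma chain_undefined: "Suc r < h \<Longrightarrow> B h = undefined"
  using B PiE_arb[of B "{0..r + 1}" "\<lambda>_. Pow {1..n}" h] by (simp add: R_chains_def)

lemma chain_finite: "h \<le> Suc r \<Longrightarrow> finite (B h)"
  using chain_sub finite_subset by blast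

lemma chain_nonempty: "h \<in> {1..Suc r} \<Longrightarrow> B h \<noteq> {}"
  using chain_card[of h] q_less_iff[of 0 h] by auto

lemma chain_mono: "h \<le> k \<Longrightarrow> k \<le> Suc r \<Longrightarrow> B h \<subseteq> B k"
proof (induction k)
  case (Suc k)
  then show ?case using chain_psubset[of k] by (cases "h = Suc k") auto
qed simp

lemma gapless_chains_iff:
  "B \<in> gapless_chains n R \<longleftrightarrow> (\<forall>h\<in>{1..r - 1}. gapless_step (B h) (B (h + 1)))"
proof -
  have "gapless_step (B r) (B (r + 1))"
    using chain_last chain_sub[of r] unfolding gapless_step_def by force
  moreover have "h \<in> {1..r} \<longleftrightarrow> h \<in> {1..r - 1} \<or> 1 \<le> h \<and> h = r" for h by auto
  ultimately show ?thesis using B unfolding gapless_chains_def by blast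
qed

end

lemma R_chains_eqI:
  assumes "B \<in> R_chains n R" "B' \<in> R_chains n R" "\<And>h. h \<in> {1..r} \<Longrightarrow> B h = B' h"
  shows "B = B'"
proof
  fix h
  consider "h = 0" | "h = Suc r" | "h \<in> {1..r}" | "Suc r < h" by fastforce
  then show "B h = B' h"
    by cases (simp_all add: assms(3) chain_0[OF assms(1)] chain_0[OF assms(2)]
        chain_last[OF assms(1)] chain_last[OF assms(2)]
        chain_undefined[OF assms(1)] chain_undefined[OF assms(2)])
qed

lemma gapless_chains_subset: "gapless_chains n R \<subseteq> R_chains n R"
  by (auto simp: gapless_chains_def)

lemma gapless_chains_stepD:
  assumes "B \<in> gapless_chains n R" "h \<le> r"
  shows "gapless_step (B h) (B (Suc h))"
  using assms chain_0[of B] by (cases "h = 0") (auto simp: gapless_chains_def gapless_step_def)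

lemma rightmost_clump_deleting_chains_eq:
  "rightmost_clump_deleting_chains n R = gapless_chains n R"
  unfolding rightmost_clump_deleting_chains_def gapless_chains_def
  by (intro Collect_cong conj_cong ball_cong refl gapless_step_iff_clumps_deleted[symmetric])
    (simp_all add: chain_finite chain_psubset)

end

section \<open>Permutations\<close>

lemma gapless_step_permutation_iff:
  fixes \<pi> :: "nat \<Rightarrow> nat"
  assumes perm: "\<pi> permutes {1..n}" and "p \<le> p'" "p' \<le> n"
  shows "gapless_step (\<pi> ` {1..p}) (\<pi> ` {1..p'}) \<longleftrightarrow>
    \<not> (\<exists>a b c. 1 \<le> a \<and> a \<le> p \<and> p < b \<and> b \<le> p' \<and> p' < c \<and> c \<le> n \<and> \<pi> b < \<pi> c \<and> \<pi> c < \<pi> a)"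
    (is "_ \<longleftrightarrow> \<not> ?containing")
proof
  have mem_iff: "\<pi> x \<in> \<pi> ` X \<longleftrightarrow> x \<in> X" for x X
    using permutes_inj[OF perm] by (rule inj_image_mem_iff)
  show "\<not> ?containing" if gap: "gapless_step (\<pi> ` {1..p}) (\<pi> ` {1..p'})"
  proof
    assume ?containing
    then obtain a b c where abc: "1 \<le> a" "a \<le> p" "p < b" "b \<le> p'" "p' < c" "\<pi> b < \<pi> c" "\<pi> c < \<pi> a"
      by blast
    then have "{\<pi> b..\<pi> a} \<subseteq> \<pi> ` {1..p'}"
      by (intro gapless_stepD[OF gap]) (auto simp: mem_iff)
    moreover have "\<pi> c \<in> {\<pi> b..\<pi> a}" using abc by simp
    ultimately have "\<pi> c \<in> \<pi> ` {1..p'}" by (rule subsetD)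
    then show False using abc(5) by (simp add: mem_iff)
  qed
  show "gapless_step (\<pi> ` {1..p}) (\<pi> ` {1..p'})" if avoiding: "\<not> ?containing"
    unfolding gapless_step_def
  proof (intro ballI subsetI)
    fix x y z assume x: "x \<in> \<pi> ` {1..p'} - \<pi> ` {1..p}" and y: "y \<in> \<pi> ` {1..p}" and z: "z \<in> {x..y}"
    obtain b where b: "x = \<pi> b" "p < b" "b \<le> p'" using x by (force simp: image_iff)
    obtain a where a: "y = \<pi> a" "1 \<le> a" "a \<le> p" using y by auto
    have "{\<pi> a, \<pi> b} \<subseteq> {1..n}" using a b assms(2,3) permutes_in_image[OF perm] by simp
    then have "z \<in> \<pi> ` {1..n}" using z a(1) b(1) permutes_image[OF perm] by auto
    then obtain c where c: "z = \<pi> c" "1 \<le> c" "c \<le> n" by auto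
    show "z \<in> \<pi> ` {1..p'}"
    proof (rule ccontr)
      assume outside: "z \<notin> \<pi> ` {1..p'}"
      then have "p' < c" using c by (simp add: mem_iff)
      moreover have "z \<noteq> x" "z \<noteq> y" using outside x y assms(2) by auto
      ultimately have ?containing using a b c z by force
      then show False using avoiding by contradiction
    qed
  qed
qed

definition chain_perm :: "nat \<Rightarrow> nat set \<Rightarrow> (nat \<Rightarrow> nat set) \<Rightarrow> nat \<Rightarrow> nat" where
  "chain_perm n R B i = (if i \<in> {1..n}
    then let h = carrel_index n R i in kth_least (B h - B (h - 1)) (i - qval n R (h - 1)) else i)"

context carrels
begin

lemma perm_chain_in_R_chains:
  assumes "\<pi> permutes {1..n}"
  shows "perm_chain n R \<pi> \<in> R_chains n R"
  unfolding perm_chain_def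
proof (rule R_chainsI)
  show "\<pi> ` {1..q h} \<subseteq> {1..n}" if "h \<le> Suc r" for h
    using image_mono[of "{1..q h}" "{1..n}" \<pi>] permutes_image[OF assms] q_le_n[OF that] by simp
  show "card (\<pi> ` {1..q h}) = q h" for h
    using card_image[OF permutes_inj_on[OF assms]] by simp
  show "\<pi> ` {1..q h} \<subseteq> \<pi> ` {1..q (Suc h)}" if "h \<le> r" for h
    using q_le_iff[of h "Suc h"] that by (intro image_mono) auto
qed

lemma perm_chain_312_iff:
  assumes "\<pi> permutes {1..n}"
  shows "\<not> R_312_containing n R \<pi> \<longleftrightarrow> perm_chain n R \<pi> \<in> gapless_chains n R"
proof -
  have "perm_chain n R \<pi> h = \<pi> ` {1..q h}" "perm_chain n R \<pi> (h + 1) = \<pi> ` {1..q (h + 1)}"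
    "q h \<le> q (h + 1)" "q (h + 1) \<le> n" if "h \<in> {1..r - 1}" for h
    using that q_le_iff[of h "h + 1"] q_le_n[of "h + 1"] by (auto simp: perm_chain_def)
  then have "(\<forall>h\<in>{1..r - 1}. gapless_step (perm_chain n R \<pi> h) (perm_chain n R \<pi> (h + 1))) \<longleftrightarrow>
      \<not> R_312_containing n R \<pi>"
    unfolding R_312_containing_def using gapless_step_permutation_iff[OF assms] by simp
  then show ?thesis using gapless_chains_iff[OF perm_chain_in_R_chains[OF assms]] by simp
qed

context
  fixes B assumes B: "B \<in> R_chains n R"
begin

lemma chain_card_Diff: "h \<le> r \<Longrightarrow> card (B (Suc h) - B h) = q (Suc h) - q h"
  using chain_psubset[OF B, of h] chain_card[OF B] chain_finite[OF B, of h]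
  by (subst card_Diff_subset) auto

lemma chain_perm_carrel:
  assumes "h \<le> r" "i \<in> carrel n R (Suc h)"
  shows "chain_perm n R B i = kth_least (B (Suc h) - B h) (i - q h)"
  using carrel_index_eqI[OF assms] carrel_subset[OF assms(1)] assms(2)
  by (auto simp: chain_perm_def)

lemma strict_mono_on_chain_perm:
  assumes "h \<le> r"
  shows "strict_mono_on (carrel n R (Suc h)) (chain_perm n R B)"
proof (rule strict_mono_onI)
  fix i k assume "i \<in> carrel n R (Suc h)" "k \<in> carrel n R (Suc h)" "i < k"
  then show "chain_perm n R B i < chain_perm n R B k"
    using chain_card_Diff[OF assms]
    by (auto simp: chain_perm_carrel[OF assms] carrel_Suc
        intro!: strict_mono_onD[OF strict_mono_on_kth_least])
qed

lemma chain_perm_image_carrel: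
  assumes "h \<le> r"
  shows "chain_perm n R B ` carrel n R (Suc h) = B (Suc h) - B h"
proof -
  let ?D = "B (Suc h) - B h"
  have "q h \<le> q (Suc h)" using q_le_iff[of h "Suc h"] assms by simp
  then have "carrel n R (Suc h) = (+) (q h) ` {1..card ?D}"
    using chain_card_Diff[OF assms] by (simp add: carrel_Suc atLeastSucAtMost_greaterThanAtMost)
  then have "chain_perm n R B ` carrel n R (Suc h) =
      (\<lambda>i. chain_perm n R B (q h + i)) ` {1..card ?D}"
    by (simp only: image_image)
  also have "\<dots> = kth_least ?D ` {1..card ?D}"
    using chain_perm_carrel[OF assms] chain_card_Diff[OF assms]
    by (intro image_cong) (auto simp: carrel_Suc)
  also have "\<dots> = ?D"
    using bij_betw_kth_least[of ?D] chain_finite[OF B] assms by (simp add: bij_betw_def)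
  finally show ?thesis .
qed

lemma chain_perm_image: "h \<le> Suc r \<Longrightarrow> chain_perm n R B ` {1..q h} = B h"
proof (induction h)
  case 0
  then show ?case using chain_0[OF B] by simp
next
  case (Suc h)
  have "{1..q (Suc h)} = {1..q h} \<union> carrel n R (Suc h)"
    using q_le_iff[of h "Suc h"] Suc.prems by (auto simp: carrel_Suc)
  then show ?case
    using Suc chain_perm_image_carrel[of h] chain_psubset[OF B, of h] by (auto simp: image_Un)
qed

lemma chain_perm_in_R_perms: "chain_perm n R B \<in> R_perms n R"
proof -
  have "chain_perm n R B ` {1..n} = {1..n}"
    using chain_perm_image[of "Suc r"] chain_last[OF B] by simp
  then have "bij_betw (chain_perm n R B) {1..n} {1..n}"
    by (auto simp: bij_betw_def intro: eq_card_imp_inj_on)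
  then have "chain_perm n R B permutes {1..n}"
    by (rule bij_imp_permutes) (auto simp: chain_perm_def)
  moreover have "carrel_increasing n R (chain_perm n R B)"
    by (rule carrel_increasingI[OF strict_mono_on_chain_perm])
  ultimately show ?thesis by (simp add: R_perms_def)
qed

lemma perm_chain_chain_perm: "perm_chain n R (chain_perm n R B) = B"
  using chain_perm_in_R_perms chain_perm_image
  by (intro R_chains_eqI[OF perm_chain_in_R_chains B]) (auto simp: R_perms_def perm_chain_def)

end

lemma perm_chain_image_avoiding: "perm_chain n R ` R_312_avoiding_perms n R = gapless_chains n R"
proof
  show "perm_chain n R ` R_312_avoiding_perms n R \<subseteq> gapless_chains n R"
    using perm_chain_312_iff by (auto simp: R_312_avoiding_perms_def R_perms_def)
  show "gapless_chains n R \<subseteq> perm_chain n R ` R_312_avoiding_perms n R"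
  proof
    fix B assume gapless: "B \<in> gapless_chains n R"
    then have B: "B \<in> R_chains n R" using gapless_chains_subset by blast
    then have "chain_perm n R B \<in> R_312_avoiding_perms n R"
      using gapless chain_perm_in_R_perms[OF B] perm_chain_312_iff perm_chain_chain_perm[OF B]
      by (auto simp: R_312_avoiding_perms_def R_perms_def)
    then show "B \<in> perm_chain n R ` R_312_avoiding_perms n R"
      using perm_chain_chain_perm[OF B] by (metis imageI)
  qed
qed

end

section \<open>Tuples\<close>

lemma interval_subset_image_iff:
  fixes f :: "nat \<Rightarrow> nat"
  assumes mono: "strict_mono_on {p<..p'} f" and "p < p'" and "f (p + 1) \<le> m"
  shows "{f (p + 1)..m} \<subseteq> f ` {p<..p'} \<longleftrightarrow>
    m - f (p + 1) < p' - p \<and> (\<forall>k\<le>m - f (p + 1). f (p + 1 + k) = f (p + 1) + k)"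
    (is "?covered \<longleftrightarrow> _ \<and> (\<forall>k\<le>?d. _)")
proof (intro iffI conjI allI impI)
  assume covered: ?covered
  have consecutive: "p + 1 + k \<le> p' \<and> f (p + 1 + k) = f (p + 1) + k" if "k \<le> ?d" for k
    using that
  proof (induction k)
    case 0
    then show ?case using \<open>p < p'\<close> by simp
  next
    case (Suc k)
    then have IH: "p + 1 + k \<in> {p<..p'}" "f (p + 1 + k) = f (p + 1) + k" by auto
    have "f (p + 1) + Suc k \<in> {f (p + 1)..m}" using Suc.prems by simp
    then have "f (p + 1) + Suc k \<in> f ` {p<..p'}" using covered by blast
    then obtain i where i: "i \<in> {p<..p'}" "f i = f (p + 1) + Suc k" by (metis imageE)
    then have "p + 1 + k < i" using strict_mono_on_less[OF mono IH(1) i(1)] IH(2) by simp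
    then have next_mem: "p + 1 + Suc k \<in> {p<..p'}" and "p + 1 + Suc k \<le> i" using i(1) by auto
    then have "f (p + 1 + Suc k) \<le> f (p + 1) + Suc k"
      using strict_mono_on_less_eq[OF mono next_mem i(1)] i(2) by simp
    moreover have "f (p + 1 + k) < f (p + 1 + Suc k)"
      using strict_mono_onD[OF mono IH(1) next_mem] by simp
    ultimately show ?case using IH(2) next_mem by simp
  qed
  then show "f (p + 1 + k) = f (p + 1) + k" if "k \<le> ?d" for k using that by blast
  show "?d < p' - p" using consecutive[of ?d] by linarith
next
  assume consecutive: "?d < p' - p \<and> (\<forall>k\<le>?d. f (p + 1 + k) = f (p + 1) + k)"
  show ?covered
  proof
    fix z assume "z \<in> {f (p + 1)..m}"
    then obtain k where k: "z = f (p + 1) + k" "k \<le> ?d" by (auto dest: le_Suc_ex)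
    then have "z = f (p + 1 + k)" using consecutive by simp
    moreover have "p + 1 + k \<in> {p<..p'}" using consecutive k(2) by auto
    ultimately show "z \<in> f ` {p<..p'}" by (rule image_eqI)
  qed
qed

definition chain_tuple :: "nat \<Rightarrow> nat set \<Rightarrow> (nat \<Rightarrow> nat set) \<Rightarrow> nat \<Rightarrow> nat" where
  "chain_tuple n R B = (\<lambda>i\<in>{1..n}. kth_least (B (carrel_index n R i)) i)"

context carrels
begin

lemma UI_le: "\<nu> \<in> UI n R \<Longrightarrow> i \<in> {1..n} \<Longrightarrow> i \<le> \<nu> i"
  unfolding UI_def by blast

lemma UI_strict_mono_on: "\<nu> \<in> UI n R \<Longrightarrow> h \<le> r \<Longrightarrow> strict_mono_on (carrel n R (Suc h)) \<nu>"
  by (auto simp: UI_def carrel_increasing_def)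

lemma UG_iff:
  "\<gamma> \<in> UG n R \<longleftrightarrow>
    \<gamma> \<in> UI n R \<and> (\<forall>h\<in>{1..r}. {\<gamma> (q h + 1)..\<gamma> (q h)} \<subseteq> \<gamma> ` carrel n R (Suc h))"
proof -
  have "{\<gamma> (q h + 1)..\<gamma> (q h)} \<subseteq> \<gamma> ` carrel n R (Suc h) \<longleftrightarrow>
      (\<gamma> (q h) > \<gamma> (q h + 1) \<longrightarrow>
        (let s = \<gamma> (q h) - \<gamma> (q h + 1) + 1 in
          s \<le> pval n R (h + 1) \<and> (\<forall>t\<in>{1..s}. \<gamma> (q h + t) = \<gamma> (q h) - s + t)))"
    if \<gamma>: "\<gamma> \<in> UI n R" and h: "h \<in> {1..r}" for h
  proof (cases "\<gamma> (q h) > \<gamma> (q h + 1)")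
    case True
    let ?c = "\<gamma> (q h + 1)" and ?m = "\<gamma> (q h)"
    have less: "q h < q (Suc h)" using q_less_iff[of h "Suc h"] h by simp
    have "q h + 1 \<in> {1..n}" using carrel_subset[of h] Suc_q_mem_carrel[of h] h by auto
    then have "1 \<le> ?c" using UI_le[OF \<gamma>] by fastforce
    then have "?m - (?m - ?c + 1) + Suc k = ?c + k" for k using True by simp
    moreover have "(\<forall>t\<in>{1..?m - ?c + 1}. P t) \<longleftrightarrow> (\<forall>k\<le>?m - ?c. P (Suc k))" for P
      unfolding Suc_eq_plus1[symmetric] image_Suc_atMost[symmetric] by auto
    ultimately show ?thesis
      using interval_subset_image_iff[of "q h" "q (Suc h)" \<gamma> ?m] UI_strict_mono_on[OF \<gamma>, of h]
        less h True
      by (simp add: Let_def pval_def carrel_Suc Suc_le_eq)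
  next
    case False
    then show ?thesis using Suc_q_mem_carrel[of h] h by (cases "\<gamma> (q h) = \<gamma> (q h + 1)") auto
  qed
  then show ?thesis unfolding UG_def mem_Collect_eq by blast
qed

context
  fixes B assumes B: "B \<in> R_chains n R"
begin

lemma chain_tuple_carrel:
  assumes "h \<le> r" "i \<in> carrel n R (Suc h)"
  shows "chain_tuple n R B i = kth_least (B (Suc h)) i"
  using carrel_index_eqI[OF assms] carrel_subset[OF assms(1)] assms(2)
  by (auto simp: chain_tuple_def)

lemma carrel_subset_ranks: "h \<le> r \<Longrightarrow> carrel n R (Suc h) \<subseteq> {1..card (B (Suc h))}"
  using chain_card[OF B, of "Suc h"] by (auto simp: carrel_Suc)

lemma strict_mono_on_chain_tuple:
  assumes "h \<le> r"
  shows "strict_mono_on (carrel n R (Suc h)) (chain_tuple n R B)"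
  using carrel_subset_ranks[OF assms] strict_mono_on_kth_least[of "B (Suc h)"]
  by (auto simp: chain_tuple_carrel[OF assms] monotone_on_def)

lemma chain_tuple_image_carrel:
  assumes "h \<le> r"
  shows "chain_tuple n R B ` carrel n R (Suc h) = B (Suc h) \<inter> {chain_tuple n R B (q h + 1)..}"
proof -
  have carrel: "carrel n R (Suc h) = {q h + 1..card (B (Suc h))}"
    using chain_card[OF B, of "Suc h"] assms by (auto simp: carrel_Suc)
  then have "q h + 1 \<in> {1..card (B (Suc h))}" using Suc_q_mem_carrel[OF assms] by auto
  then have "kth_least (B (Suc h)) ` carrel n R (Suc h) =
      B (Suc h) \<inter> {kth_least (B (Suc h)) (q h + 1)..}"
    unfolding carrel using chain_finite[OF B, of "Suc h"] assms
    by (intro kth_least_image_atLeast) auto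
  then show ?thesis using chain_tuple_carrel[OF assms] Suc_q_mem_carrel[OF assms] by simp
qed

lemma chain_tuple_q_Suc:
  assumes "h \<le> r"
  shows "chain_tuple n R B (q (Suc h)) = Max (B (Suc h))"
  using chain_tuple_carrel[OF assms q_Suc_mem_carrel[OF assms]] assms
    kth_least_card[OF chain_finite[OF B] chain_nonempty[OF B], of "Suc h"]
    chain_card[OF B, of "Suc h"]
  by simp

lemma chain_tuple_in_UI: "chain_tuple n R B \<in> UI n R"
proof -
  have "i \<le> chain_tuple n R B i \<and> chain_tuple n R B i \<le> n" if i: "i \<in> {1..n}" for i
  proof -
    obtain h where h: "h \<le> r" "i \<in> carrel n R (Suc h)" using carrel_index_cases[OF i] by blast
    then have "i \<in> {1..card (B (Suc h))}" using carrel_subset_ranks by blast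
    moreover have fin: "finite (B (Suc h))" and sub: "B (Suc h) \<subseteq> {1..n}"
      using chain_finite[OF B] chain_sub[OF B] h(1) by auto
    moreover from sub have "B (Suc h) \<subseteq> {1..}" by auto
    ultimately show ?thesis
      using le_kth_least[of "B (Suc h)" i] kth_least_mem[of "B (Suc h)" i] chain_tuple_carrel[OF h]
      by auto
  qed
  moreover have "carrel_increasing n R (chain_tuple n R B)"
    by (rule carrel_increasingI[OF strict_mono_on_chain_tuple])
  ultimately show ?thesis by (auto simp: UI_def PiE_iff chain_tuple_def intro: order.trans)
qed

end

lemma Psi_eq_chain_tuple:
  assumes "\<pi> permutes {1..n}"
  shows "Psi n R \<pi> = chain_tuple n R (perm_chain n R \<pi>)"
  unfolding Psi_def chain_tuple_def carrel_index_def[symmetric] Let_def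
proof (rule restrict_ext)
  fix i assume i: "i \<in> {1..n}"
  obtain h where h: "h \<le> r" "carrel_index n R i = Suc h" "i \<in> carrel n R (Suc h)"
    using carrel_index_cases[OF i] .
  note B = perm_chain_in_R_chains[OF assms]
  have chain: "perm_chain n R \<pi> (Suc h) = \<pi> ` {1..q (Suc h)}"
    using h(1) by (simp add: perm_chain_def)
  then have "card (\<pi> ` {1..q (Suc h)}) = q (Suc h)"
    using chain_card[OF B, of "Suc h"] h(1) by simp
  then have "rank_desc (q (Suc h) - i + 1) (\<pi> ` {1..q (Suc h)}) = kth_least (\<pi> ` {1..q (Suc h)}) i"
    using rank_desc_eq_kth_least[of "\<pi> ` {1..q (Suc h)}" i] h(3) by (auto simp: carrel_Suc)
  then show "rank_desc (q (carrel_index n R i) - i + 1) (\<pi> ` {1..q (carrel_index n R i)}) =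
      kth_least (perm_chain n R \<pi> (carrel_index n R i)) i"
    unfolding h(2) chain .
qed

lemma chain_tuple_in_UG:
  assumes "B \<in> gapless_chains n R"
  shows "chain_tuple n R B \<in> UG n R"
  unfolding UG_iff
proof (intro conjI ballI)
  have B: "B \<in> R_chains n R" using assms gapless_chains_subset by blast
  show "chain_tuple n R B \<in> UI n R" by (rule chain_tuple_in_UI[OF B])
  fix h assume h: "h \<in> {1..r}"
  let ?\<gamma> = "chain_tuple n R B"
  have "B h \<noteq> {}" using chain_nonempty[OF B] h by simp
  then have "Max (B h) \<in> B h" using chain_finite[OF B, of h] h by simp
  then have "{kth_least (B (Suc h)) (q h + 1)..Max (B h)} \<subseteq> B (Suc h)"
    using gapless_step_above[of "B (Suc h)" "B h"] chain_finite[OF B] chain_psubset[OF B]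
      gapless_chains_stepD[OF assms] chain_card[OF B, of h] h by simp
  moreover have "?\<gamma> (q h + 1) = kth_least (B (Suc h)) (q h + 1)"
    using chain_tuple_carrel[OF B] Suc_q_mem_carrel h by simp
  moreover have "?\<gamma> (q h) = Max (B h)" using chain_tuple_q_Suc[OF B, of "h - 1"] h by auto
  ultimately show "{?\<gamma> (q h + 1)..?\<gamma> (q h)} \<subseteq> ?\<gamma> ` carrel n R (Suc h)"
    using chain_tuple_image_carrel[OF B] h by auto
qed

lemma
  assumes "\<nu> \<in> UI n R" "h \<le> r"
  shows UI_carrel_image_subset: "\<nu> ` carrel n R (Suc h) \<subseteq> {1..n}"
    and card_UI_carrel_image: "card (\<nu> ` carrel n R (Suc h)) = q (Suc h) - q h"
    and Min_UI_carrel_image: "Min (\<nu> ` carrel n R (Suc h)) = \<nu> (q h + 1)"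
proof -
  note mono = UI_strict_mono_on[OF assms]
  show "\<nu> ` carrel n R (Suc h) \<subseteq> {1..n}"
    using assms(1) carrel_subset[OF assms(2)] by (auto simp: UI_def)
  show "card (\<nu> ` carrel n R (Suc h)) = q (Suc h) - q h"
    using strict_mono_on_imp_inj_on[OF mono] by (simp add: card_image carrel_Suc)
  show "Min (\<nu> ` carrel n R (Suc h)) = \<nu> (q h + 1)"
    using strict_mono_on_leD[OF mono Suc_q_mem_carrel[OF assms(2)]] Suc_q_mem_carrel[OF assms(2)]
    by (intro Min_eqI) (auto simp: carrel_Suc)
qed

lemma UG_chain_step:
  assumes \<gamma>: "\<gamma> \<in> UG n R" and h: "h \<le> r" and B: "B \<subseteq> {1..n}" "card B = q h"
    and top: "h \<noteq> 0 \<Longrightarrow> kth_least B (q h) = \<gamma> (q h)"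
  obtains B' where "B' \<subseteq> {1..n}" "card B' = q (Suc h)" "B \<subseteq> B'" "gapless_step B B'"
    "\<And>i. i \<in> carrel n R (Suc h) \<Longrightarrow> kth_least B' i = \<gamma> i"
proof -
  let ?U = "\<gamma> ` carrel n R (Suc h)"
  have UI: "\<gamma> \<in> UI n R" using \<gamma> UG_iff by blast
  note mono = UI_strict_mono_on[OF UI h]
    and U = UI_carrel_image_subset[OF UI h] card_UI_carrel_image[OF UI h]
      Min_UI_carrel_image[OF UI h]
  have fin: "finite B" "finite ?U" using B(1) U(1) finite_subset by blast+
  have first: "\<gamma> (q h + 1) \<in> ?U" using Suc_q_mem_carrel[OF h] by blast
  have below_U: "card B < Min ?U"
    using UI_le[OF UI, of "q h + 1"] carrel_subset[OF h] Suc_q_mem_carrel[OF h]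
    unfolding B(2) U(3) by force
  have cover: "{Min ?U..y} \<subseteq> ?U" if y: "y \<in> B" for y
  proof -
    have "card B \<noteq> 0" using fin(1) y by auto
    then have "h \<noteq> 0" unfolding B(2) by (metis q_0)
    have "y \<le> kth_least B (card B)" using kth_least_card fin(1) y by fastforce
    then have "{Min ?U..y} \<subseteq> {\<gamma> (q h + 1)..\<gamma> (q h)}" using U(3) B(2) top \<open>h \<noteq> 0\<close> by simp
    also have "\<dots> \<subseteq> ?U" using \<gamma> h \<open>h \<noteq> 0\<close> UG_iff by simp
    finally show ?thesis .
  qed
  have "B \<subseteq> {1..}" "?U \<noteq> {}" using B(1) first by auto
  then obtain L where L: "L \<subseteq> {1..<Min ?U}" "card L = card B" "B \<subseteq> L \<union> ?U" "gapless_step B (L \<union> ?U)"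
    using gapless_extension[OF fin(1) _ fin(2) _ below_U cover] by blast
  have finL: "finite L" using finite_subset[OF L(1)] by simp
  have below: "x < y" if "x \<in> L" "y \<in> ?U" for x y
    using L(1) that(1) Min_le[OF fin(2) that(2)] by auto
  show thesis
  proof (rule that[OF _ _ L(3,4)])
    show "L \<union> ?U \<subseteq> {1..n}" using L(1) U(1) Min_in[OF fin(2)] first by fastforce
    show "card (L \<union> ?U) = q (Suc h)"
      using finL fin(2) U(2) below L(2) B(2) q_le_iff[of h "Suc h"] h
      by (subst card_Un_disjoint) auto
    show "kth_least (L \<union> ?U) i = \<gamma> i" if "i \<in> carrel n R (Suc h)" for i
      using kth_least_Un_image_above[OF finL, of "q (Suc h)" \<gamma> i] mono below that L(2) B(2)
      by (simp add: carrel_Suc)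
  qed
qed

lemma UG_chain_exists:
  assumes \<gamma>: "\<gamma> \<in> UG n R"
  obtains B where "B \<in> gapless_chains n R"
    "\<And>h i. h \<le> r \<Longrightarrow> i \<in> carrel n R (Suc h) \<Longrightarrow> kth_least (B (Suc h)) i = \<gamma> i"
proof -
  let ?member = "\<lambda>h B. h \<le> Suc r \<longrightarrow> B \<subseteq> {1..n} \<and> card B = q h \<and>
    (\<forall>i\<in>carrel n R h. kth_least B i = \<gamma> i)"
  let ?step = "\<lambda>h B B'. h \<le> r \<longrightarrow> B \<subseteq> B' \<and> gapless_step B B'"
  have "\<exists>B. \<forall>h. ?member h (B h) \<and> ?step h (B h) (B (Suc h))"
  proof (rule dependent_nat_choice)
    show "\<exists>B. ?member 0 B" by (rule exI[of _ "{}"]) (simp add: carrel_def)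
    fix B h assume member: "?member h B"
    show "\<exists>B'. ?member (Suc h) B' \<and> ?step h B B'"
    proof (cases "h \<le> r")
      case True
      then have B: "B \<subseteq> {1..n}" "card B = q h" "\<forall>i\<in>carrel n R h. kth_least B i = \<gamma> i"
        using member by auto
      moreover have "q h \<in> carrel n R h" if "h \<noteq> 0"
        using q_Suc_mem_carrel[of "h - 1"] True that by simp
      ultimately have "h \<noteq> 0 \<Longrightarrow> kth_least B (q h) = \<gamma> (q h)" by blast
      then obtain B' where "B' \<subseteq> {1..n}" "card B' = q (Suc h)" "B \<subseteq> B'" "gapless_step B B'"
          "\<And>i. i \<in> carrel n R (Suc h) \<Longrightarrow> kth_least B' i = \<gamma> i"
        using UG_chain_step[OF \<gamma> True B(1,2)] by blast
      then show ?thesis by blast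
    qed auto
  qed
  then obtain B where B: "\<And>h. ?member h (B h) \<and> ?step h (B h) (B (Suc h))" by blast
  let ?B = "restrict B {0..r + 1}"
  have "?B \<in> R_chains n R" by (rule R_chainsI) (use B in blast)+
  then have "?B \<in> gapless_chains n R" using B by (simp add: gapless_chains_def)
  moreover have "kth_least (?B (Suc h)) i = \<gamma> i" if "h \<le> r" "i \<in> carrel n R (Suc h)" for h i
    using B[of "Suc h"] that by simp
  ultimately show thesis by (rule that)
qed

lemma chain_tuple_surj:
  assumes \<gamma>: "\<gamma> \<in> UG n R"
  obtains B where "B \<in> gapless_chains n R" "chain_tuple n R B = \<gamma>"
proof -
  obtain B where B: "B \<in> gapless_chains n R"
    "\<And>h i. h \<le> r \<Longrightarrow> i \<in> carrel n R (Suc h) \<Longrightarrow> kth_least (B (Suc h)) i = \<gamma> i"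
    using UG_chain_exists[OF \<gamma>] by blast
  have "chain_tuple n R B = \<gamma>"
  proof (rule extensionalityI)
    show "chain_tuple n R B \<in> extensional {1..n}" by (simp add: chain_tuple_def)
    show "\<gamma> \<in> extensional {1..n}" using \<gamma> by (simp add: UG_def UI_def PiE_iff)
    fix i assume i: "i \<in> {1..n}"
    obtain h where h: "h \<le> r" "i \<in> carrel n R (Suc h)" using carrel_index_cases[OF i] by blast
    then show "chain_tuple n R B i = \<gamma> i"
      using B(2) chain_tuple_carrel gapless_chains_subset B(1) by auto
  qed
  then show thesis using that B(1) by blast
qed

lemma chain_tuple_image: "chain_tuple n R ` gapless_chains n R = UG n R"
  using chain_tuple_in_UG chain_tuple_surj by blast

end

section \<open>Tableaux given by their columns\<close>

definition columns_tableau ::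
    "nat \<Rightarrow> (nat \<Rightarrow> nat) \<Rightarrow> (nat \<Rightarrow> nat set) \<Rightarrow> nat \<times> nat \<Rightarrow> nat" where
  "columns_tableau n lam C = (\<lambda>(j, i)\<in>boxes n lam. kth_least (C j) i)"

lemma boxes_iff: "(j, i) \<in> boxes n lam \<longleftrightarrow> j \<in> {1..lam 1} \<and> i \<in> {1..col_len n lam j}"
  by (simp add: boxes_def)

lemma columns_tableau_cong:
  assumes "\<And>j. j \<in> {1..lam 1} \<Longrightarrow> C j = C' j"
  shows "columns_tableau n lam C = columns_tableau n lam C'"
  unfolding columns_tableau_def by (rule restrict_ext) (use assms in \<open>auto simp: boxes_def\<close>)

lemma col_set_eq_image: "col_set n lam T j = (\<lambda>i. T (j, i)) ` {1..col_len n lam j}"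
  by (auto simp: col_set_def)

lemma col_set_columns_tableau:
  assumes "j \<in> {1..lam 1}" "finite (C j)" "card (C j) = col_len n lam j"
  shows "col_set n lam (columns_tableau n lam C) j = C j"
proof -
  have "col_set n lam (columns_tableau n lam C) j = kth_least (C j) ` {1..col_len n lam j}"
    unfolding col_set_eq_image using assms(1)
    by (intro image_cong) (auto simp: columns_tableau_def boxes_iff)
  also have "\<dots> = C j" using bij_betw_kth_least[OF assms(2)] assms(3) by (simp add: bij_betw_def)
  finally show ?thesis .
qed

lemma columns_tableau_in_lam_keys:
  assumes sub: "\<And>j. j \<in> {1..lam 1} \<Longrightarrow> C j \<subseteq> {1..n}"
    and card: "\<And>j. j \<in> {1..lam 1} \<Longrightarrow> card (C j) = col_len n lam j"
    and nested: "\<And>j l. j \<in> {1..lam 1} \<Longrightarrow> l \<in> {1..lam 1} \<Longrightarrow> j \<le> l \<Longrightarrow> C l \<subseteq> C j"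
  shows "columns_tableau n lam C \<in> lam_keys n lam"
proof -
  let ?Y = "columns_tableau n lam C"
  have fin: "finite (C j)" if "j \<in> {1..lam 1}" for j using sub[OF that] finite_subset by blast
  have Y: "?Y (j, i) = kth_least (C j) i" "j \<in> {1..lam 1}" "i \<in> {1..card (C j)}"
    if "(j, i) \<in> boxes n lam" for j i
    using that card by (auto simp: columns_tableau_def boxes_iff)
  have "?Y (j, i) \<in> {1..n}" if "(j, i) \<in> boxes n lam" for j i
    using kth_least_mem[OF fin[OF Y(2)[OF that]] Y(3)[OF that]] sub[OF Y(2)[OF that]]
    unfolding Y(1)[OF that] by blast
  then have "?Y \<in> boxes n lam \<rightarrow>\<^sub>E {1..n}" by (auto simp: columns_tableau_def)
  moreover have "?Y (j, i) < ?Y (j, k)"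
    if "(j, i) \<in> boxes n lam" "(j, k) \<in> boxes n lam" "i < k" for j i k
    using strict_mono_onD[OF strict_mono_on_kth_least Y(3)[OF that(1)] Y(3)[OF that(2)] that(3)]
    by (simp only: Y(1)[OF that(1)] Y(1)[OF that(2)])
  moreover have "?Y (j, i) \<le> ?Y (l, i)"
    if "(j, i) \<in> boxes n lam" "(l, i) \<in> boxes n lam" "j \<le> l" for j l i
    using kth_least_antimono[OF fin nested Y(3)[OF that(2)]]
      Y(2)[OF that(1)] Y(2)[OF that(2)] that(3)
    by (simp only: Y(1)[OF that(1)] Y(1)[OF that(2)])
  ultimately have "?Y \<in> tableaux n lam" unfolding tableaux_def by blast
  moreover have "col_set n lam ?Y j = C j" if "j \<in> {1..lam 1}" for j
    using that fin card by (intro col_set_columns_tableau)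
  ultimately show ?thesis using nested by (simp add: lam_keys_def)
qed

lemma
  assumes T: "T \<in> tableaux n lam" and j: "j \<in> {1..lam 1}"
  shows strict_mono_on_tableau_column: "strict_mono_on {1..col_len n lam j} (\<lambda>i. T (j, i))"
    and col_set_subset: "col_set n lam T j \<subseteq> {1..n}"
    and card_col_set: "card (col_set n lam T j) = col_len n lam j"
proof -
  show mono: "strict_mono_on {1..col_len n lam j} (\<lambda>i. T (j, i))"
    using T j by (intro strict_mono_onI) (simp add: tableaux_def boxes_iff)
  show "card (col_set n lam T j) = col_len n lam j"
    unfolding col_set_eq_image using strict_mono_on_imp_inj_on[OF mono] by (simp add: card_image)
  have "T (j, i) \<in> {1..n}" if "i \<in> {1..col_len n lam j}" for i
    using T j that PiE_mem[of T "boxes n lam" "\<lambda>_. {1..n}" "(j, i)"]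
    by (simp add: tableaux_def boxes_iff)
  then show "col_set n lam T j \<subseteq> {1..n}" unfolding col_set_eq_image by blast
qed

lemma lam_keys_tableaux: "Y \<in> lam_keys n lam \<Longrightarrow> Y \<in> tableaux n lam"
  by (simp add: lam_keys_def)

lemma lam_keys_nested:
  "Y \<in> lam_keys n lam \<Longrightarrow> l \<in> {1..lam 1} \<Longrightarrow> j \<in> {1..lam 1} \<Longrightarrow> l \<le> j \<Longrightarrow>
    col_set n lam Y j \<subseteq> col_set n lam Y l"
  unfolding lam_keys_def by blast

lemma col_set_eq_if_col_len_eq:
  assumes Y: "Y \<in> lam_keys n lam" and j: "j \<in> {1..lam 1}" and l: "l \<in> {1..lam 1}"
    and len: "col_len n lam j = col_len n lam l"
  shows "col_set n lam Y j = col_set n lam Y l"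
proof -
  have card: "card (col_set n lam Y j) = card (col_set n lam Y l)"
    using card_col_set[OF lam_keys_tableaux[OF Y]] j l len by simp
  have fin: "finite (col_set n lam Y k)" for k by (simp add: col_set_eq_image)
  show ?thesis
  proof (cases "j \<le> l")
    case True
    then show ?thesis using card_subset_eq[OF fin lam_keys_nested[OF Y j l]] card by simp
  next
    case False
    then show ?thesis using card_subset_eq[OF fin lam_keys_nested[OF Y l j]] card by simp
  qed
qed

lemma columns_tableau_col_set:
  assumes T: "T \<in> tableaux n lam"
  shows "columns_tableau n lam (col_set n lam T) = T"
proof (rule extensionalityI)
  show "columns_tableau n lam (col_set n lam T) \<in> extensional (boxes n lam)"
    by (simp add: columns_tableau_def)
  show "T \<in> extensional (boxes n lam)" using T by (simp add: tableaux_def PiE_iff)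
  fix x assume x: "x \<in> boxes n lam"
  obtain j i where ji: "x = (j, i)" by (cases x)
  then have j: "j \<in> {1..lam 1}" and i: "i \<in> {1..col_len n lam j}" using x by (auto simp: boxes_iff)
  have "kth_least (col_set n lam T j) i = T (j, kth_least {1..col_len n lam j} i)"
    unfolding col_set_eq_image using i
    by (intro kth_least_image[OF _ strict_mono_on_tableau_column[OF T j]]) auto
  also have "kth_least {1..col_len n lam j} i = i"
    using kth_least_greaterThanAtMost[of i "col_len n lam j" 0] i
    by (simp add: atLeastSucAtMost_greaterThanAtMost)
  finally show "columns_tableau n lam (col_set n lam T) x = T x"
    using x ji by (simp add: columns_tableau_def)
qed

lemma tableau_column_gap:
  assumes "T \<in> tableaux n lam" "(j, i) \<in> boxes n lam" "i + t \<le> col_len n lam j"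
  shows "T (j, i) + t \<le> T (j, i + t)"
  using assms(3)
proof (induction t)
  case (Suc t)
  then have "T (j, i + t) < T (j, i + Suc t)"
    using assms(1,2) by (auto simp: tableaux_def boxes_iff)
  then show ?case using Suc by simp
qed simp

lemma row_end_max_eqI:
  assumes Y: "Y \<in> tableaux_with_row_ends n lam \<alpha>"
    and ub: "\<And>T x. T \<in> tableaux_with_row_ends n lam \<alpha> \<Longrightarrow> x \<in> boxes n lam \<Longrightarrow> T x \<le> Y x"
  shows "row_end_max n lam \<alpha> = Y"
proof (rule extensionalityI)
  show "row_end_max n lam \<alpha> \<in> extensional (boxes n lam)" by (simp add: row_end_max_def)
  show "Y \<in> extensional (boxes n lam)"
    using Y by (simp add: tableaux_with_row_ends_def tableaux_def PiE_iff)
  fix x assume x: "x \<in> boxes n lam"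
  have ub_x: "T x \<le> Y x" if "T \<in> tableaux_with_row_ends n lam \<alpha>" for T
    by (rule ub[OF that x])
  have "Max {T x | T. T \<in> tableaux_with_row_ends n lam \<alpha>} = Y x"
  proof (rule Max_eqI)
    show "finite {T x | T. T \<in> tableaux_with_row_ends n lam \<alpha>}"
      by (rule finite_subset[of _ "{..Y x}"]) (use ub_x in blast, simp)
  qed (use Y ub_x in blast)+
  then show "row_end_max n lam \<alpha> x = Y x" using x by (simp add: row_end_max_def)
qed

lemma nth_concat_replicate_differences:
  fixes f :: "nat \<Rightarrow> nat"
  assumes "\<And>h k. m \<le> h \<Longrightarrow> h \<le> k \<Longrightarrow> k \<le> m' \<Longrightarrow> f k \<le> f h"
    and "h \<in> {m..<m'}" "f (Suc h) \<le> j + f m'" "j + f m' < f h"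
  shows "concat (map (\<lambda>k. replicate (f k - f (Suc k)) (x k)) (rev [m..<m'])) ! j = x h"
  using assms
proof (induction m' arbitrary: j)
  case (Suc m')
  let ?k = "f m' - f (Suc m')"
  have step: "f (Suc m') \<le> f m'" and split: "[m..<Suc m'] = [m..<m'] @ [m']"
    using Suc.prems(1)[of m' "Suc m'"] Suc.prems(2) by auto
  show ?case
  proof (cases "h = m'")
    case True
    then have "j < ?k" using Suc.prems(4) by simp
    then show ?thesis unfolding split using True by (simp add: nth_append)
  next
    case False
    then have h: "h \<in> {m..<m'}" using Suc.prems(2) by auto
    then have "f m' \<le> f (Suc h)" using Suc.prems(1)[of "Suc h" m'] by simp
    then have j: "?k \<le> j" "(j - ?k) + f m' = j + f (Suc m')" using Suc.prems(3) step by auto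
    have "concat (map (\<lambda>k. replicate (f k - f (Suc k)) (x k)) (rev [m..<m'])) ! (j - ?k) = x h"
      using Suc.prems(1,3,4) h j(2) by (intro Suc.IH) auto
    then show ?thesis unfolding split using j(1) by (simp add: nth_append)
  qed
qed simp

section \<open>The shape of a partition\<close>

locale partition_shape =
  fixes n :: nat and lam :: "nat \<Rightarrow> nat"
  assumes n_ge_1: "1 \<le> n" and partition: "is_partition n lam"
begin

abbreviation "R \<equiv> R_of n lam"
abbreviation "\<zeta> \<equiv> col_len n lam"

lemma lam_antimono: "1 \<le> i \<Longrightarrow> i \<le> k \<Longrightarrow> k \<le> n \<Longrightarrow> lam k \<le> lam i"
  using partition by (auto simp: is_partition_def)

lemma le_col_len_iff:
  assumes "i \<in> {1..n}"
  shows "i \<le> \<zeta> j \<longleftrightarrow> j \<le> lam i"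
proof
  let ?S = "{i \<in> {1..n}. j \<le> lam i}"
  show "i \<le> \<zeta> j" if "j \<le> lam i"
  proof -
    have "{1..i} \<subseteq> ?S" using that assms lam_antimono[of _ i] by (auto intro: order_trans)
    then have "card {1..i} \<le> card ?S" by (intro card_mono) auto
    then show ?thesis by (simp add: col_len_def)
  qed
  show "j \<le> lam i" if "i \<le> \<zeta> j"
  proof (rule ccontr)
    assume "\<not> j \<le> lam i"
    then have "k < i" if "k \<in> ?S" for k
      using that lam_antimono[of i k] assms by (cases "k < i") auto
    then have "?S \<subseteq> {1..<i}" by auto
    then have "card ?S \<le> card {1..<i}" by (intro card_mono) auto
    then have "\<zeta> j \<le> i - 1" by (simp add: col_len_def)
    then show False using \<open>i \<le> \<zeta> j\<close> assms by auto
  qed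
qed

lemma col_len_le: "\<zeta> j \<le> n"
proof -
  have "\<zeta> j \<le> card {1..n}" unfolding col_len_def by (intro card_mono) auto
  then show ?thesis by simp
qed

lemma col_len_antimono: "j \<le> l \<Longrightarrow> \<zeta> l \<le> \<zeta> j"
  unfolding col_len_def by (intro card_mono) auto

lemma col_len_pos: "j \<le> lam 1 \<Longrightarrow> 1 \<le> \<zeta> j"
  using le_col_len_iff[of 1 j] n_ge_1 by simp

sublocale carrels n "R_of n lam"
proof
  show "R \<subseteq> {1..<n}" using col_len_pos by (auto simp: R_of_def)
qed (rule n_ge_1)

lemma row_q: "h \<le> r \<Longrightarrow> q (Suc h) \<in> {1..n}"
  using carrel_subset q_Suc_mem_carrel by blast

abbreviation level :: "nat \<Rightarrow> nat" where
  "level j \<equiv> carrel_index n R (\<zeta> j)"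

lemma boxes_row: "(j, i) \<in> boxes n lam \<Longrightarrow> i \<in> {1..n}"
  using col_len_le[of j] by (auto simp: boxes_iff)

lemma column_level_cases:
  assumes "j \<in> {1..lam 1}"
  obtains h where "h \<le> r" "level j = Suc h" "\<zeta> j = q (Suc h)"
proof -
  obtain h where h: "h \<le> r" "\<zeta> j = q (Suc h)"
  proof (cases "\<zeta> j = n")
    case True
    then show ?thesis using that[of r] by simp
  next
    case False
    then have "\<zeta> j \<in> R" using assms col_len_le[of j] unfolding R_of_def by (auto simp: less_le)
    then obtain k where "k \<in> {1..r}" "\<zeta> j = q k" using q_image by (metis imageE)
    then show ?thesis using that[of "k - 1"] by auto
  qed
  then show thesis using that carrel_index_q by simp
qed

lemma q_level: "j \<in> {1..lam 1} \<Longrightarrow> q (level j) = \<zeta> j"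
  by (erule column_level_cases) simp

lemma level_le: "j \<in> {1..lam 1} \<Longrightarrow> level j \<le> Suc r"
  by (erule column_level_cases) simp

lemma level_antimono:
  assumes "j \<in> {1..lam 1}" "l \<in> {1..lam 1}" "j \<le> l"
  shows "level l \<le> level j"
  using q_le_iff[OF level_le level_le] q_level col_len_antimono[OF assms(3)] assms(1,2) by metis

lemma carrel_index_le_level:
  assumes "(j, i) \<in> boxes n lam"
  shows "carrel_index n R i \<le> level j"
proof -
  have j: "j \<in> {1..lam 1}" and "i \<le> \<zeta> j" using assms by (auto simp: boxes_iff)
  then show ?thesis using carrel_index_le_iff[OF boxes_row[OF assms] level_le[OF j]] q_level by simp
qed

lemma col_len_lam:
  assumes i: "i \<in> {1..n}"
  shows "\<zeta> (lam i) = q (carrel_index n R i)"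
proof (rule antisym)
  obtain h where h: "h \<le> r" "carrel_index n R i = Suc h" "i \<in> carrel n R (Suc h)"
    using carrel_index_cases[OF i] .
  show "\<zeta> (lam i) \<le> q (carrel_index n R i)"
  proof (cases "h = r")
    case True
    then show ?thesis using h(2) col_len_le by simp
  next
    case False
    then have "q (Suc h) \<in> R" using q_image h(1) by force
    then obtain j where j: "q (Suc h) = \<zeta> j" by (auto simp: R_of_def)
    then have "j \<le> lam i" using le_col_len_iff[OF i] h(3) by (auto simp: carrel_Suc)
    then show ?thesis using col_len_antimono j h(2) by simp
  qed
  show "q (carrel_index n R i) \<le> \<zeta> (lam i)"
  proof (cases "lam i = 0")
    case True
    then show ?thesis using le_col_len_iff[of n 0] n_ge_1 q_le_n[of "Suc h"] h(1,2) by simp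
  next
    case False
    then have "lam i \<in> {1..lam 1}" using lam_antimono[of 1 i] i by simp
    then obtain k where k: "k \<le> r" "\<zeta> (lam i) = q (Suc k)" using column_level_cases by blast
    have "i \<le> q (Suc k)" using le_col_len_iff[OF i, of "lam i"] k(2) by simp
    then have "carrel_index n R i \<le> Suc k" using carrel_index_le_iff[OF i] k(1) by simp
    then show ?thesis using q_le_iff[of "Suc h" "Suc k"] h k by simp
  qed
qed

lemma col_len_lam_q: "h \<le> r \<Longrightarrow> \<zeta> (lam (q (Suc h))) = q (Suc h)"
  using col_len_lam[OF row_q] carrel_index_q by simp

lemma level_lam_q: "h \<le> r \<Longrightarrow> level (lam (q (Suc h))) = Suc h"
  using col_len_lam_q carrel_index_q by simp

lemma lam_q_column:
  assumes "h < r"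
  shows "lam (q (Suc h)) \<in> {1..lam 1}"
proof -
  have row: "q (Suc h) \<in> {1..n}" using row_q assms by simp
  have "q (Suc h) \<in> R" using q_image assms by force
  then obtain j where "q (Suc h) = \<zeta> j" "1 \<le> j" by (auto simp: R_of_def)
  then have "1 \<le> lam (q (Suc h))" using le_col_len_iff[OF row, of j] by simp
  then show ?thesis using lam_antimono[of 1 "q (Suc h)"] row by simp
qed

section \<open>Portrayals of chains\<close>

lemma portrayal_columns_nth:
  assumes "B (Suc r) = {1..n}" and j: "j \<in> {1..lam 1}"
  shows "portrayal_columns n lam B ! (j - 1) = B (level j)"
proof -
  obtain h where h: "h \<le> r" "level j = Suc h" "\<zeta> j = q (Suc h)" using column_level_cases[OF j] .
  have upper: "j \<le> lam (q (Suc h))" using le_col_len_iff[OF row_q[OF h(1)], of j] h(3) by simp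
  have antimono: "lam (q k) \<le> lam (q k')" if "1 \<le> k'" "k' \<le> k" "k \<le> r + 1" for k k'
    using row_q[of "k - 1"] row_q[of "k' - 1"] q_le_iff[of k' k] that by (intro lam_antimono) auto
  let ?L = "concat (map (\<lambda>h. replicate (lam (q h) - lam (q (Suc h))) (B h)) (rev [1..<r + 1]))"
  have columns: "portrayal_columns n lam B = replicate (lam n) {1..n} @ ?L"
    by (simp add: portrayal_columns_def Let_def)
  show ?thesis
  proof (cases "h = r")
    case True
    then have "j - 1 < lam n" using upper j by auto
    then show ?thesis unfolding columns using True assms(1) h(2) by (simp add: nth_append)
  next
    case False
    then have lower: "lam (q (Suc (Suc h))) < j"
      using le_col_len_iff[OF row_q[of "Suc h"], of j] q_less_iff[of "Suc h" "Suc (Suc h)"] h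
      by simp
    then have "lam n < j" using antimono[of "Suc (Suc h)" "r + 1"] False h(1) by simp
    then have "\<not> j - 1 < lam n" by simp
    have "?L ! (j - 1 - lam n) = B (Suc h)"
      using lower upper antimono \<open>lam n < j\<close> False h(1)
      by (intro nth_concat_replicate_differences[where f = "\<lambda>h. lam (q h)"]) auto
    then show ?thesis unfolding columns using \<open>\<not> j - 1 < lam n\<close> h(2) by (simp add: nth_append)
  qed
qed

context
  fixes B assumes B: "B \<in> R_chains n R"
begin

lemma portrayal_eq_columns_tableau: "portrayal n lam B = columns_tableau n lam (\<lambda>j. B (level j))"
  unfolding portrayal_def columns_tableau_def
  using portrayal_columns_nth[of B, OF chain_last[OF B]]
  by (intro restrict_ext) (auto simp: boxes_iff kth_least_def)

lemma portrayal_apply: "(j, i) \<in> boxes n lam \<Longrightarrow> portrayal n lam B (j, i) = kth_least (B (level j)) i"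
  by (simp add: portrayal_eq_columns_tableau columns_tableau_def)

lemma card_chain_level: "j \<in> {1..lam 1} \<Longrightarrow> card (B (level j)) = \<zeta> j"
  using chain_card[OF B level_le] q_level by simp

lemma portrayal_in_lam_keys: "portrayal n lam B \<in> lam_keys n lam"
  unfolding portrayal_eq_columns_tableau
  using chain_sub[OF B level_le] card_chain_level chain_mono[OF B level_antimono level_le]
  by (rule columns_tableau_in_lam_keys)

lemma col_set_portrayal: "j \<in> {1..lam 1} \<Longrightarrow> col_set n lam (portrayal n lam B) j = B (level j)"
  unfolding portrayal_eq_columns_tableau
  using chain_finite[OF B level_le] card_chain_level by (intro col_set_columns_tableau)

lemma values_in_cols_portrayal:
  assumes "h \<in> {1..r}"
  shows "values_in_cols_of_length n lam (portrayal n lam B) (q h) = B h"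
proof -
  obtain k where k: "h = Suc k" "k < r" using assms by (cases h) auto
  have "carrel_index n R (q h) = h" using carrel_index_q k by simp
  then have "col_set n lam (portrayal n lam B) j = B h"
    if "j \<in> {j \<in> {1..lam 1}. \<zeta> j = q h}" for j using col_set_portrayal that by simp
  moreover have "lam (q h) \<in> {j \<in> {1..lam 1}. \<zeta> j = q h}"
    using lam_q_column[OF k(2)] col_len_lam_q[of k] k by simp
  ultimately show ?thesis unfolding values_in_cols_of_length_def by blast
qed

lemma portrayal_gapless_iff: "portrayal n lam B \<in> gapless_keys n lam \<longleftrightarrow> B \<in> gapless_chains n R"
proof -
  let ?V = "values_in_cols_of_length n lam (portrayal n lam B)"
  have "gapless_step (B h) (B (h + 1)) \<longleftrightarrow>
      (Min (?V (q (h + 1)) - ?V (q h)) < Max (?V (q h)) \<longrightarrow>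
        {Min (?V (q (h + 1)) - ?V (q h))..Max (?V (q h))} \<subseteq> ?V (q (h + 1)))"
    if "h \<in> {1..r - 1}" for h
  proof -
    have h: "h \<in> {1..r}" "h + 1 \<in> {1..r}" using that by auto
    have "B h \<noteq> {}" using chain_nonempty[OF B] h(1) by simp
    then show ?thesis
      unfolding values_in_cols_portrayal[OF h(1)] values_in_cols_portrayal[OF h(2)]
      using chain_finite[OF B, of "h + 1"] chain_psubset[OF B, of h] h
      by (intro gapless_step_iff_Min_Max) auto
  qed
  then show ?thesis
    unfolding gapless_chains_iff[OF B] gapless_keys_def Let_def
    using portrayal_in_lam_keys by blast
qed

end

lemma inj_on_portrayal: "inj_on (portrayal n lam) (R_chains n R)"
  using values_in_cols_portrayal by (intro inj_onI R_chains_eqI) metis+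

definition key_chain :: "(nat \<times> nat \<Rightarrow> nat) \<Rightarrow> nat \<Rightarrow> nat set" where
  "key_chain Y = (\<lambda>h\<in>{0..r + 1}.
     if h = 0 then {} else if h \<le> r then col_set n lam Y (lam (q h)) else {1..n})"

lemma key_chain_in_R_chains:
  assumes Y: "Y \<in> lam_keys n lam"
  shows "key_chain Y \<in> R_chains n R"
  unfolding key_chain_def
proof (rule R_chainsI)
  let ?C = "col_set n lam Y"
  let ?B = "\<lambda>h. if h = 0 then {} else if h \<le> r then ?C (lam (q h)) else {1..n}"
  note sub = col_set_subset[OF lam_keys_tableaux[OF Y]]
    and card = card_col_set[OF lam_keys_tableaux[OF Y]]
  show B_sub: "?B h \<subseteq> {1..n}" for h
    using sub[OF lam_q_column[of "h - 1"]] by (cases h) auto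
  show "card (?B h) = q h" if "h \<le> Suc r" for h
    using card[OF lam_q_column[of "h - 1"]] col_len_lam_q[of "h - 1"] that
    by (cases "h = Suc r") auto
  show "?B h \<subseteq> ?B (Suc h)" if h: "h \<le> r" for h
  proof -
    consider (bottom) "h = 0" | (top) "h = r" | (between) k where "h = Suc k" "Suc k < r"
      using h not0_implies_Suc le_neq_implies_less by blast
    then show ?thesis
    proof cases
      case top
      then show ?thesis using B_sub[of h] by simp
    next
      case between
      have "lam (q (Suc (Suc k))) \<le> lam (q (Suc k))"
        using row_q[of k] row_q[of "Suc k"] q_le_iff[of "Suc k" "Suc (Suc k)"] between
        by (intro lam_antimono) auto
      then show ?thesis
        using lam_keys_nested[OF Y] lam_q_column[of k] lam_q_column[of "Suc k"] between by simp
    qed simp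
  qed
qed

lemma key_chain_level:
  assumes Y: "Y \<in> lam_keys n lam" and j: "j \<in> {1..lam 1}"
  shows "key_chain Y (level j) = col_set n lam Y j"
proof -
  obtain h where h: "h \<le> r" "level j = Suc h" "\<zeta> j = q (Suc h)" using column_level_cases[OF j] .
  show ?thesis
  proof (cases "h = r")
    case True
    have "col_set n lam Y j = {1..n}"
      using col_set_subset[OF lam_keys_tableaux[OF Y] j] card_col_set[OF lam_keys_tableaux[OF Y] j]
        h(3) True
      by (intro card_subset_eq) auto
    then show ?thesis using h True by (simp add: key_chain_def)
  next
    case False
    then have "h < r" using h(1) by simp
    then have "col_set n lam Y (lam (q (Suc h))) = col_set n lam Y j"
      using col_set_eq_if_col_len_eq[OF Y lam_q_column j] col_len_lam_q[of h] h(3) by simp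
    then show ?thesis using h(2) \<open>h < r\<close> by (simp add: key_chain_def)
  qed
qed

lemma portrayal_key_chain:
  assumes Y: "Y \<in> lam_keys n lam"
  shows "portrayal n lam (key_chain Y) = Y"
proof -
  have "portrayal n lam (key_chain Y) = columns_tableau n lam (col_set n lam Y)"
    unfolding portrayal_eq_columns_tableau[OF key_chain_in_R_chains[OF Y]]
    by (rule columns_tableau_cong[OF key_chain_level[OF Y]])
  then show ?thesis using columns_tableau_col_set[OF lam_keys_tableaux[OF Y]] by simp
qed

lemma bij_betw_portrayal: "bij_betw (portrayal n lam) (gapless_chains n R) (gapless_keys n lam)"
proof (rule bij_betw_imageI)
  show "inj_on (portrayal n lam) (gapless_chains n R)"
    using inj_on_portrayal gapless_chains_subset by (rule inj_on_subset)
  show "portrayal n lam ` gapless_chains n R = gapless_keys n lam"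
  proof
    show "portrayal n lam ` gapless_chains n R \<subseteq> gapless_keys n lam"
      using portrayal_gapless_iff gapless_chains_subset by blast
    show "gapless_keys n lam \<subseteq> portrayal n lam ` gapless_chains n R"
    proof
      fix Y assume Y: "Y \<in> gapless_keys n lam"
      then have "Y \<in> lam_keys n lam" by (simp add: gapless_keys_def)
      then have "portrayal n lam (key_chain Y) = Y" "key_chain Y \<in> gapless_chains n R"
        using Y portrayal_key_chain portrayal_gapless_iff[OF key_chain_in_R_chains] by simp_all
      then show "Y \<in> portrayal n lam ` gapless_chains n R" by (metis imageI)
    qed
  qed
qed

section \<open>Row ends\<close>

lemma row_end_box:
  assumes "(j, i) \<in> boxes n lam"
  shows "j \<le> lam i" "(lam i, i) \<in> boxes n lam"
proof -
  have i: "i \<in> {1..n}" and j: "1 \<le> j" "i \<le> \<zeta> j" using assms boxes_row by (auto simp: boxes_iff)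
  then show "j \<le> lam i" using le_col_len_iff by blast
  then show "(lam i, i) \<in> boxes n lam"
    using i j(1) le_col_len_iff[OF i, of "lam i"] lam_antimono[of 1 i] by (simp add: boxes_iff)
qed

lemma next_level_neighbours:
  assumes box: "(j, i) \<in> boxes n lam" and level: "level j = Suc h"
    and earlier: "carrel_index n R i \<le> h"
  shows "i \<le> q h" "(j, q h + 1) \<in> boxes n lam"
    and "(lam (q h), i) \<in> boxes n lam" "j \<le> lam (q h)" "level (lam (q h)) = h"
proof -
  have j: "j \<in> {1..lam 1}" and i: "1 \<le> i" using box by (auto simp: boxes_iff)
  have h: "h \<le> r" "\<zeta> j = q (Suc h)" using level_le[OF j] q_level[OF j] level by simp_all
  show row_le: "i \<le> q h" using carrel_index_le_iff[OF boxes_row[OF box], of h] earlier h(1) by simp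
  show "(j, q h + 1) \<in> boxes n lam"
    using Suc_q_mem_carrel[OF h(1)] j h(2) by (simp add: boxes_iff carrel_Suc)
  obtain k where k: "h = Suc k" using row_le i by (cases h) auto
  then have "k < r" using h(1) by simp
  then show "(lam (q h), i) \<in> boxes n lam" "level (lam (q h)) = h"
    using lam_q_column[of k] col_len_lam_q[of k] level_lam_q[of k] row_le i k
    by (simp_all add: boxes_iff)
  show "j \<le> lam (q h)"
    using le_col_len_iff[OF row_q[of k], of j] q_le_iff[of h "Suc h"] h k by simp
qed

lemma level_lam: "i \<in> {1..n} \<Longrightarrow> level (lam i) = carrel_index n R i"
  using col_len_lam carrel_index_cases carrel_index_q by metis

lemma portrayal_row_ends:
  assumes B: "B \<in> R_chains n R"
  shows "portrayal n lam B \<in> tableaux_with_row_ends n lam (chain_tuple n R B)"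
proof -
  have "portrayal n lam B (lam i, i) = chain_tuple n R B i" if i: "i \<in> {1..n}" "1 \<le> lam i" for i
  proof -
    have "(1, i) \<in> boxes n lam"
      using i le_col_len_iff[of i 1] lam_antimono[of 1 i] by (simp add: boxes_iff)
    then show ?thesis
      using portrayal_apply[OF B row_end_box(2)] level_lam i(1) by (simp add: chain_tuple_def)
  qed
  then show ?thesis using portrayal_in_lam_keys[OF B]
    by (simp add: tableaux_with_row_ends_def lam_keys_def)
qed

context
  fixes B T
  assumes gapless: "B \<in> gapless_chains n R"
    and row_ends: "T \<in> tableaux_with_row_ends n lam (chain_tuple n R B)"
begin

lemma row_ends_tableau: "T \<in> tableaux n lam"
  using row_ends by (simp add: tableaux_with_row_ends_def)

lemma row_ends_weakly_increasing:
  "(j, i) \<in> boxes n lam \<Longrightarrow> (l, i) \<in> boxes n lam \<Longrightarrow> j \<le> l \<Longrightarrow> T (j, i) \<le> T (l, i)"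
  using row_ends_tableau by (simp add: tableaux_def)

lemma le_portrayal_last_carrel:
  assumes box: "(j, i) \<in> boxes n lam" and "carrel_index n R i = level j"
  shows "T (j, i) \<le> kth_least (B (level j)) i"
proof -
  have i: "i \<in> {1..n}" by (rule boxes_row[OF box])
  have "T (j, i) \<le> T (lam i, i)"
    using row_ends_weakly_increasing[OF box] row_end_box[OF box] by blast
  also have "\<dots> = chain_tuple n R B i"
    using row_ends i row_end_box(2)[OF box] by (simp add: tableaux_with_row_ends_def boxes_iff)
  also have "\<dots> = kth_least (B (level j)) i" using i assms(2) by (simp add: chain_tuple_def)
  finally show ?thesis .
qed

lemma le_portrayal:
  assumes "(j, i) \<in> boxes n lam"
  shows "T (j, i) \<le> kth_least (B (level j)) i"
  using assms
proof (induction "level j" arbitrary: j rule: less_induct)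
  case less
  note box = less.prems
  have j: "j \<in> {1..lam 1}" and i: "i \<in> {1..\<zeta> j}" using box by (auto simp: boxes_iff)
  have "carrel_index n R i \<le> level j" by (rule carrel_index_le_level[OF box])
  then consider (last) "carrel_index n R i = level j" | (earlier) "carrel_index n R i < level j"
    by linarith
  then show ?case
  proof cases
    case last
    then show ?thesis by (rule le_portrayal_last_carrel[OF box])
  next
    case earlier
    obtain h where h: "h \<le> r" "level j = Suc h" using column_level_cases[OF j] by blast
    then have "carrel_index n R i \<le> h" using earlier by linarith
    note neighbours = next_level_neighbours[OF box h(2) this]
    have B: "B \<in> R_chains n R" using gapless gapless_chains_subset by blast
    have card: "card (B h) = q h" using chain_card[OF B] h(1) by simp
    then have rank: "i \<in> {1..card (B h)}" using i neighbours(1) by simp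
    have "T (j, i) \<le> T (lam (q h), i)"
      using neighbours by (intro row_ends_weakly_increasing[OF box])
    also have "\<dots> \<le> kth_least (B h) i"
      using less.hyps[OF _ neighbours(3)] neighbours(5) h(2) by simp
    finally have right: "T (j, i) \<le> kth_least (B h) i" .
    have "T (j, i) + (q h + 1 - i) \<le> T (j, q h + 1)"
      using tableau_column_gap[OF row_ends_tableau box, of "q h + 1 - i"] neighbours(1,2)
      by (simp add: boxes_iff)
    also have "\<dots> \<le> kth_least (B (Suc h)) (q h + 1)"
      using le_portrayal_last_carrel[OF neighbours(2)] h(2)
        carrel_index_eqI[OF h(1) Suc_q_mem_carrel[OF h(1)]] by simp
    finally have "T (j, i) + (card (B h) + 1 - i) \<le> kth_least (B (Suc h)) (card (B h) + 1)"
      unfolding card .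
    then show ?thesis
      using le_kth_least_gapless[OF chain_finite[OF B] chain_psubset[OF B h(1)]
          gapless_chains_stepD[OF gapless h(1)] rank right] h(1,2) by simp
  qed
qed

end

lemma row_end_max_chain_tuple:
  assumes gapless: "B \<in> gapless_chains n R"
  shows "row_end_max n lam (chain_tuple n R B) = portrayal n lam B"
proof (rule row_end_max_eqI)
  have B: "B \<in> R_chains n R" using gapless gapless_chains_subset by blast
  show "portrayal n lam B \<in> tableaux_with_row_ends n lam (chain_tuple n R B)"
    by (rule portrayal_row_ends[OF B])
  fix T x assume T: "T \<in> tableaux_with_row_ends n lam (chain_tuple n R B)" and x: "x \<in> boxes n lam"
  then show "T x \<le> portrayal n lam B x"
    using le_portrayal[OF gapless T] portrayal_apply[OF B] by (cases x) simp
qed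

lemma bij_betw_row_end_max: "bij_betw (row_end_max n lam) (UG n R) (gapless_keys n lam)"
proof -
  have "bij_betw (row_end_max n lam \<circ> chain_tuple n R) (gapless_chains n R) (gapless_keys n lam)"
    using bij_betw_portrayal row_end_max_chain_tuple by (simp cong: bij_betw_cong)
  then show ?thesis unfolding chain_tuple_image[symmetric]
    by (auto simp: bij_betw_def image_comp intro: inj_on_imageI)
qed

lemma key_of_gapless_iff:
  assumes "\<pi> \<in> R_perms n R"
  shows "key_of n lam \<pi> \<in> gapless_keys n lam \<longleftrightarrow> \<not> R_312_containing n R \<pi>"
  using assms portrayal_gapless_iff perm_chain_in_R_chains perm_chain_312_iff
  by (simp add: key_of_def R_perms_def)

lemma key_of_image_avoiding: "key_of n lam ` R_312_avoiding_perms n R = gapless_keys n lam"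
proof -
  have "key_of n lam = portrayal n lam \<circ> perm_chain n R" by (simp add: fun_eq_iff key_of_def)
  then show ?thesis
    using bij_betw_imp_surj_on[OF bij_betw_portrayal]
    by (simp only: image_comp[symmetric] perm_chain_image_avoiding)
qed

lemma Psi_image_avoiding: "Psi n R ` R_312_avoiding_perms n R = UG n R"
proof -
  have "Psi n R ` R_312_avoiding_perms n R =
      chain_tuple n R ` perm_chain n R ` R_312_avoiding_perms n R"
    unfolding image_image using Psi_eq_chain_tuple
    by (intro image_cong) (auto simp: R_312_avoiding_perms_def R_perms_def)
  then show ?thesis unfolding perm_chain_image_avoiding chain_tuple_image .
qed

lemma row_end_max_Psi:
  assumes "\<pi> \<in> R_312_avoiding_perms n R"
  shows "row_end_max n lam (Psi n R \<pi>) = key_of n lam \<pi>"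
proof -
  have "\<pi> permutes {1..n}" using assms by (simp add: R_312_avoiding_perms_def R_perms_def)
  moreover have "perm_chain n R \<pi> \<in> gapless_chains n R"
    using assms perm_chain_image_avoiding by blast
  ultimately show ?thesis by (simp add: Psi_eq_chain_tuple row_end_max_chain_tuple key_of_def)
qed

end

theorem theorem9p2:
  fixes n :: nat and lam :: "nat \<Rightarrow> nat" and R :: "nat set"
    and A C :: "(nat \<Rightarrow> nat) set" and B :: "(nat \<Rightarrow> nat set) set"
    and P_lam Q_lam R_lam :: "(nat \<times> nat \<Rightarrow> nat) set"
  assumes "n \<ge> 1" and "is_partition n lam"
    and "R = R_of n lam"
    and "A = R_312_avoiding_perms n R"
    and "P_lam = key_of n lam ` A"
    and "B = rightmost_clump_deleting_chains n R"
    and "Q_lam = gapless_keys n lam"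
    and "C = UG n R"
    and "R_lam = row_end_max n lam ` C"
  shows
    "(bij_betw (portrayal n lam) B Q_lam \<and>
      bij_betw (row_end_max n lam) C R_lam) \<and>
     (P_lam = Q_lam \<and>
      induces (perm_chain n R) A B (key_of n lam) P_lam (portrayal n lam) Q_lam id \<and>
      (\<forall>\<pi>\<in>R_perms n R. \<not> R_312_containing n R \<pi> \<longleftrightarrow> key_of n lam \<pi> \<in> gapless_keys n lam)) \<and>
     ((\<forall>\<pi>\<in>R_perms n R. \<not> R_312_containing n R \<pi> \<longrightarrow>
         row_end_max n lam (Psi n R \<pi>) = key_of n lam \<pi>) \<and>
      P_lam = R_lam \<and>
      induces (Psi n R) A C (key_of n lam) P_lam (row_end_max n lam) R_lam id)"
proof -
  interpret partition_shape n lam using assms(1,2) by unfold_locales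
  note R = assms(3)
  have B: "B = gapless_chains n R"
    using rightmost_clump_deleting_chains_eq assms(6) R by simp
  have portrayal: "bij_betw (portrayal n lam) B Q_lam"
    using bij_betw_portrayal B R assms(7) by simp
  have max_Q: "bij_betw (row_end_max n lam) C Q_lam"
    using bij_betw_row_end_max R assms(7,8) by simp
  then have R_lam: "R_lam = Q_lam" using assms(9) by (simp add: bij_betw_def)
  have P_lam: "P_lam = Q_lam" using key_of_image_avoiding R assms(4,5,7) by simp
  have max_Psi: "row_end_max n lam (Psi n R \<pi>) = key_of n lam \<pi>" if "\<pi> \<in> A" for \<pi>
    using row_end_max_Psi that R assms(4) by simp
  have "induces (perm_chain n R) A B (key_of n lam) P_lam (portrayal n lam) Q_lam id"
    using perm_chain_image_avoiding portrayal P_lam B R assms(4,5)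
    by (auto simp: induces_def bij_betw_def key_of_def)
  moreover have "induces (Psi n R) A C (key_of n lam) P_lam (row_end_max n lam) R_lam id"
    using Psi_image_avoiding max_Psi P_lam R_lam R assms(4,5,8,9) by (auto simp: induces_def)
  moreover have "\<forall>\<pi>\<in>R_perms n R. \<not> R_312_containing n R \<pi> \<longleftrightarrow> key_of n lam \<pi> \<in> gapless_keys n lam"
    using key_of_gapless_iff R by blast
  moreover have "\<forall>\<pi>\<in>R_perms n R. \<not> R_312_containing n R \<pi> \<longrightarrow>
      row_end_max n lam (Psi n R \<pi>) = key_of n lam \<pi>"
    using max_Psi assms(4) by (simp add: R_312_avoiding_perms_def)
  ultimately show ?thesis using portrayal max_Q P_lam R_lam by blast
qed

end
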